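(* Let $N\in\mathbb N$ and fix a vertex $\varkappa$ of $H(N,2)$, with subconstituent algebra $T=T(\varkappa)$. The map $\vartheta:P_N\to T$ is an isomorphism of $\mathfrak{sl}_4(\mathbb C)$-modules.
   Context: $\mathbb N=\{0,1,2,\ldots\}$; all vector spaces are over $\mathbb C$. Lie algebra and polynomials: with $E_{a,b}$ the $4\times4$ matrix units, define in $\mathfrak{sl}_4(\mathbb C)$: $A_1=E_{12}+E_{21}+E_{34}+E_{43}$, $A_2=E_{13}+E_{31}+E_{24}+E_{42}$, $A_3=E_{14}+E_{41}+E_{23}+E_{32}$, $A_1^*={\rm diag}(1,1,-1,-1)$, $A_2^*={\rm diag}(1,-1,1,-1)$, $A_3^*={\rm diag}(1,-1,-1,1)$. These generate $\mathfrak{sl}_4(\mathbb C)$. $P=\mathbb C[x,y,z,w]$ is an $\mathfrak{sl}_4(\mathbb C)$-module on which every element acts as a derivation, and on the degree-one part $\varphi\in\mathfrak{sl}_4(\mathbb C)$ acts by its matrix with respect to the ordered basis $(v_1,v_2,v_3,v_4)=(x,y,z,w)$, i.e. $\varphi v_b=\sum_a\varphi_{ab}v_a$. $P_N$ is the submodule of homogeneous polynomials of total degree $N$; $\mathcal P_N$ is the set of $(r,s,t,u)\in\mathbb N^4$ with $r+s+t+u=N$. Hypercube: $H(N,2)$ is the graph with vertex set $X=\{1,-1\}^N$, two vertices adjacent when they differ in exactly one coordinate; $\partial$ is path-length distance; $\Gamma_i(x)=\{y\in X:\partial(x,y)=i\}$. $V$ is the vector space with basis $X$, with the Hermitian form (linear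 in the first argument) for which $X$ is orthonormal. $V^{\otimes3}$ has basis $X^{\otimes 3}=\{x\otimes y\otimes z:x,y,z\in X\}$. $G$ is the automorphism group of the graph, acting linearly on $V$ by permuting $X$ and diagonally on $V^{\otimes 3}$; ${\rm Fix}(G)=\{v\in V^{\otimes3}:g(v)=v\ \forall g\in G\}$. Put $\theta_i=\theta_i^*=N-2i$. ${\sf A}_h\in{\rm End}(V)$ is given by ${\sf A}_hx=\sum_{\xi\in\Gamma_h(x)}\xi$ for $x\in X$; the adjacency map ${\sf A}$ sends each vertex to the sum of its neighbours and is diagonalizable with eigenvalues $\theta_i$ $(0\le i\le N)$; ${\sf E}_i$ is the primitive idempotent of ${\sf A}$ for $\theta_i$ (projection onto that eigenspace along the other eigenspaces). For $x\in X$: ${\sf A}^*x=\theta^*_{\partial(x,\varkappa)}x$; ${\sf E}_i^*x=x$ if $\partial(x,\varkappa)=i$ and ${\sf E}^*_ix=0$ otherwise; ${\sf A}^*_hx=2^N\langle{\sf E}_h\varkappa,x\rangle x$. $T$ is the subalgebra of ${\rm End}(V)$ generated by ${\sf A},{\sf A}^*$. Module structure on $T$: $\mathcal P''_N$ is the set of integer triples $(h,i,j)$ with $0\le h,i,j\le N$, $h+i+j$ even, $h+i+j\le 2N$, $h\le i+j$, $i\le j+h$, $j\le h+i$. The elements ${\sf E}_i{\sf A}_h^*{\sf E}_j$, $(h,i,j)\in\mathcal P''_N$, form a basis of $T$, and so do the elements ${\sf E}_i^*{\sf A}_h{\sf E}_j^*$, $(h,i,j)\in\mathcal P''_N$. $T$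 is the $\mathfrak{sl}_4(\mathbb C)$-module on which $A_1,A_2,A_3$ multiply ${\sf E}_i{\sf A}_h^*{\sf E}_j$ by $\theta_h,\theta_i,\theta_j$ respectively, and $A^*_1,A^*_2,A^*_3$ multiply ${\sf E}^*_i{\sf A}_h{\sf E}^*_j$ by $\theta^*_h,\theta^*_j,\theta^*_i$ respectively, for all $(h,i,j)\in\mathcal P''_N$. The map $\vartheta$: the profile of $x\otimes y\otimes z\in X^{\otimes 3}$ is $(r,s,t,u)\in\mathcal P_N$, where $r=|\{i:x_i=y_i=z_i\}|$, $s=|\{i:x_i\ne y_i=z_i\}|$, $t=|\{i:y_i\neq z_i=x_i\}|$, $u=|\{i:z_i\ne x_i=y_i\}|$. $B(r,s,t,u)$ is the sum of all elements of $X^{\otimes3}$ with profile $(r,s,t,u)$ and $\tilde B(r,s,t,u)=\frac{r!s!t!u!}{N!\,2^N}B(r,s,t,u)$; these form a basis of ${\rm Fix}(G)$. The linear isomorphism $\ddag:P_N\to{\rm Fix}(G)$ sends $x^ry^sz^tw^u\mapsto(N!\,2^N)^{1/2}\tilde B(r,s,t,u)$. With $e_{x,y}\in{\rm End}(V)$ sending $y\mapsto x$ and all other vertices to $0$, the linear map $\varepsilon:V^{\otimes 3}\to{\rm End}(V)$ is given by $\varepsilon(x\otimes y\otimes z)=2^{N/2}e_{y,z}$ if $x=\varkappa$ and $0$ if $x\ne\varkappa$; it maps ${\rm Fix}(G)$ bijectively onto $T$. The map $\vartheta:P_N\to T$ is $f\mapsto\varepsilon(f^\ddag)$. *)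

theory Defs
  imports
    "HOL-Analysis.Analysis"
    "HOL-Library.Poly_Mapping"
    "HOL-Library.Function_Algebras"
begin

section \<open>Free complex vector spaces\<close>

text \<open>
  The complex vector space with basis a set \<open>S\<close> is realised as the set of finitely supported
  functions (type \<open>'a \<Rightarrow>\<^sub>0 complex\<close>) with support contained in \<open>S\<close>.
\<close>

definition pscale :: "complex \<Rightarrow> ('a \<Rightarrow>\<^sub>0 complex) \<Rightarrow> ('a \<Rightarrow>\<^sub>0 complex)" where
  "pscale c f = Poly_Mapping.map (\<lambda>a. c * a) f"

abbreviation bvec :: "'a \<Rightarrow> ('a \<Rightarrow>\<^sub>0 complex)" where
  "bvec x \<equiv> Poly_Mapping.single x 1"

definition lin_ext :: "('a \<Rightarrow> ('b \<Rightarrow>\<^sub>0 complex)) \<Rightarrow> ('a \<Rightarrow>\<^sub>0 complex) \<Rightarrow> ('b \<Rightarrow>\<^sub>0 complex)" where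
  "lin_ext g f = (\<Sum>x\<in>Poly_Mapping.keys f. pscale (Poly_Mapping.lookup f x) (g x))"

lemma lookup_pscale [simp]: "Poly_Mapping.lookup (pscale c f) x = c * Poly_Mapping.lookup f x"
  by (simp add: pscale_def Poly_Mapping.map.rep_eq when_def)

interpretation pv: vector_space pscale
  by standard (auto intro!: poly_mapping_eqI simp: lookup_add algebra_simps)

lemma lin_ext_superset:
  assumes "finite S" "Poly_Mapping.keys f \<subseteq> S"
  shows "lin_ext g f = (\<Sum>x\<in>S. pscale (Poly_Mapping.lookup f x) (g x))"
  unfolding lin_ext_def
  by (rule sum.mono_neutral_left) (use assms in \<open>auto simp: in_keys_iff\<close>)

lemma linear_lin_ext:
  fixes g :: "'a \<Rightarrow> ('b \<Rightarrow>\<^sub>0 complex)"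
  shows "Vector_Spaces.linear pscale pscale (lin_ext g)"
proof (unfold_locales)
  fix f h :: "'a \<Rightarrow>\<^sub>0 complex"
  let ?S = "Poly_Mapping.keys f \<union> Poly_Mapping.keys h"
  have "lin_ext g (f + h) = (\<Sum>x\<in>?S. pscale (Poly_Mapping.lookup (f + h) x) (g x))"
    by (rule lin_ext_superset) (auto dest: subsetD[OF Poly_Mapping.keys_add])
  then show "lin_ext g (f + h) = lin_ext g f + lin_ext g h"
    by (simp add: lin_ext_superset[of ?S f] lin_ext_superset[of ?S h]
        lookup_add pv.scale_left_distrib sum.distrib)
next
  fix c and f :: "'a \<Rightarrow>\<^sub>0 complex"
  have "lin_ext g (pscale c f)
      = (\<Sum>x\<in>Poly_Mapping.keys f. pscale (Poly_Mapping.lookup (pscale c f) x) (g x))"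
    by (rule lin_ext_superset) (auto simp: in_keys_iff)
  then show "lin_ext g (pscale c f) = pscale c (lin_ext g f)"
    by (simp add: lin_ext_def pv.scale_sum_right)
qed

lemma lin_ext_bvec [simp]: "lin_ext g (bvec x) = g x"
  by (simp add: lin_ext_def)

lemma linear_eq_on_bvec:
  fixes F G :: "('a \<Rightarrow>\<^sub>0 complex) \<Rightarrow> ('b \<Rightarrow>\<^sub>0 complex)"
  assumes F: "Vector_Spaces.linear pscale pscale F" and G: "Vector_Spaces.linear pscale pscale G"
    and eq: "\<And>x. F (bvec x) = G (bvec x)"
  shows "F = G"
proof
  fix f :: "'a \<Rightarrow>\<^sub>0 complex"
  interpret F: Vector_Spaces.linear pscale pscale F by (rule F)
  interpret G: Vector_Spaces.linear pscale pscale G by (rule G)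
  have "f = (\<Sum>x\<in>Poly_Mapping.keys f. pscale (Poly_Mapping.lookup f x) (bvec x))"
    by (rule poly_mapping_eqI)
      (auto simp: lookup_sum lookup_single when_def in_keys_iff if_distrib cong: if_cong)
  then obtain S c where f: "f = (\<Sum>x\<in>S. pscale (c x) (bvec x))" by blast
  show "F f = G f"
    unfolding f by (simp add: F.sum G.sum F.scale G.scale eq)
qed

section \<open>The Lie algebra \<open>sl\<^sub>4\<close> and its modules\<close>

definition sl4 :: "(complex^4^4) set" where
  "sl4 = {\<phi>. trace \<phi> = 0}"

definition mscale :: "complex \<Rightarrow> complex^4^4 \<Rightarrow> complex^4^4" where
  "mscale c \<phi> = (\<chi> a b. c * \<phi> $ a $ b)"

definition lie_bracket :: "complex^4^4 \<Rightarrow> complex^4^4 \<Rightarrow> complex^4^4" where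
  "lie_bracket \<phi> \<psi> = \<phi> ** \<psi> - \<psi> ** \<phi>"

definition mat_unit :: "4 \<Rightarrow> 4 \<Rightarrow> complex^4^4" where
  "mat_unit a b = (\<chi> i j. if i = a \<and> j = b then 1 else 0)"

definition A1 :: "complex^4^4" where
  "A1 = mat_unit 1 2 + mat_unit 2 1 + mat_unit 3 4 + mat_unit 4 3"
definition A2 :: "complex^4^4" where
  "A2 = mat_unit 1 3 + mat_unit 3 1 + mat_unit 2 4 + mat_unit 4 2"
definition A3 :: "complex^4^4" where
  "A3 = mat_unit 1 4 + mat_unit 4 1 + mat_unit 2 3 + mat_unit 3 2"

definition A1s :: "complex^4^4" where
  "A1s = mat_unit 1 1 + mat_unit 2 2 - mat_unit 3 3 - mat_unit 4 4"
definition A2s :: "complex^4^4" where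
  "A2s = mat_unit 1 1 - mat_unit 2 2 + mat_unit 3 3 - mat_unit 4 4"
definition A3s :: "complex^4^4" where
  "A3s = mat_unit 1 1 - mat_unit 2 2 - mat_unit 3 3 + mat_unit 4 4"

text \<open>
  A module is a subspace \<open>M\<close> of an ambient vector space with scalar multiplication \<open>s\<close>,
  together with an action \<open>\<rho>\<close>, of which only the values on \<open>sl4\<close> and \<open>M\<close> matter.
\<close>

definition linear_on_subspace ::
  "(complex \<Rightarrow> 'a::ab_group_add \<Rightarrow> 'a) \<Rightarrow> (complex \<Rightarrow> 'b::ab_group_add \<Rightarrow> 'b) \<Rightarrow> 'a set \<Rightarrow> ('a \<Rightarrow> 'b) \<Rightarrow> bool" where
  "linear_on_subspace s s' M f \<longleftrightarrow>
     (\<forall>m\<in>M. \<forall>n\<in>M. f (m + n) = f m + f n) \<and> (\<forall>c. \<forall>m\<in>M. f (s c m) = s' c (f m))"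

definition sl4_module ::
  "(complex \<Rightarrow> 'a::ab_group_add \<Rightarrow> 'a) \<Rightarrow> 'a set \<Rightarrow> (complex^4^4 \<Rightarrow> 'a \<Rightarrow> 'a) \<Rightarrow> bool" where
  "sl4_module s M \<rho> \<longleftrightarrow>
     vector_space s \<and> module.subspace s M \<and>
     (\<forall>\<phi>\<in>sl4. \<rho> \<phi> ` M \<subseteq> M \<and> linear_on_subspace s s M (\<rho> \<phi>)) \<and>
     (\<forall>\<phi>\<in>sl4. \<forall>\<psi>\<in>sl4. \<forall>m\<in>M. \<rho> (\<phi> + \<psi>) m = \<rho> \<phi> m + \<rho> \<psi> m) \<and>
     (\<forall>c. \<forall>\<phi>\<in>sl4. \<forall>m\<in>M. \<rho> (mscale c \<phi>) m = s c (\<rho> \<phi> m)) \<and>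
     (\<forall>\<phi>\<in>sl4. \<forall>\<psi>\<in>sl4. \<forall>m\<in>M.
        \<rho> (lie_bracket \<phi> \<psi>) m = \<rho> \<phi> (\<rho> \<psi> m) - \<rho> \<psi> (\<rho> \<phi> m))"

definition sl4_module_iso ::
  "(complex \<Rightarrow> 'a::ab_group_add \<Rightarrow> 'a) \<Rightarrow> 'a set \<Rightarrow> (complex^4^4 \<Rightarrow> 'a \<Rightarrow> 'a) \<Rightarrow>
   (complex \<Rightarrow> 'b::ab_group_add \<Rightarrow> 'b) \<Rightarrow> 'b set \<Rightarrow> (complex^4^4 \<Rightarrow> 'b \<Rightarrow> 'b) \<Rightarrow> ('a \<Rightarrow> 'b) \<Rightarrow> bool" where
  "sl4_module_iso s M \<rho> s' M' \<rho>' f \<longleftrightarrow>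
     sl4_module s M \<rho> \<and> sl4_module s' M' \<rho>' \<and>
     linear_on_subspace s s' M f \<and> bij_betw f M M' \<and>
     (\<forall>\<phi>\<in>sl4. \<forall>m\<in>M. f (\<rho> \<phi> m) = \<rho>' \<phi> (f m))"

section \<open>The polynomial module\<close>

text \<open>
  \<open>poly4\<close> is the ring of complex polynomials in \<open>x, y, z, w\<close>, which are \<open>var 1, \<dots>, var 4\<close>;
  a monomial is given by its exponent vector of type \<open>4 \<Rightarrow>\<^sub>0 nat\<close>.
\<close>

type_synonym poly4 = "(4 \<Rightarrow>\<^sub>0 nat) \<Rightarrow>\<^sub>0 complex"

definition var :: "4 \<Rightarrow> poly4" where
  "var b = bvec (Poly_Mapping.single b 1)"

definition PN :: "nat \<Rightarrow> poly4 set" where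
  "PN N = {f. \<forall>m\<in>Poly_Mapping.keys f. (\<Sum>b\<in>UNIV. Poly_Mapping.lookup m b) = N}"

definition partial :: "4 \<Rightarrow> poly4 \<Rightarrow> poly4" where
  "partial b = lin_ext (\<lambda>m. Poly_Mapping.single (m - Poly_Mapping.single b 1)
                              (of_nat (Poly_Mapping.lookup m b)))"

definition P_act :: "complex^4^4 \<Rightarrow> poly4 \<Rightarrow> poly4" where
  "P_act \<phi> f = (\<Sum>b\<in>UNIV. (\<Sum>a\<in>UNIV. pscale (\<phi> $ a $ b) (var a)) * partial b f)"

definition derivation :: "(poly4 \<Rightarrow> poly4) \<Rightarrow> bool" where
  "derivation D \<longleftrightarrow> Vector_Spaces.linear pscale pscale D \<and> (\<forall>f g. D (f * g) = D f * g + f * D g)"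

lemma pscale_conv_mult: "pscale c f = Poly_Mapping.single 0 c * (f :: poly4)"
  unfolding pscale_def using mult_map_scale_conv_mult[of c f] by simp

lemma partial_var: "partial b (var c) = (if b = c then 1 else 0)"
  by (simp add: partial_def var_def lookup_single when_def single_one)

lemma partial_monomials:
  fixes m n :: "4 \<Rightarrow>\<^sub>0 nat"
  shows "partial b (bvec m * bvec n) = partial b (bvec m) * bvec n + bvec m * partial b (bvec n)"
proof -
  let ?e = "Poly_Mapping.single b (1::nat)"
  have shift: "p - ?e + q = p + q - ?e" if "Poly_Mapping.lookup p b \<noteq> 0" for p q :: "4 \<Rightarrow>\<^sub>0 nat"
    using that by (intro poly_mapping_eqI) (auto simp: lookup_add lookup_minus lookup_single when_def)
  have left: "Poly_Mapping.single (m - ?e + n) (of_nat (Poly_Mapping.lookup m b) :: complex)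
      = Poly_Mapping.single (m + n - ?e) (of_nat (Poly_Mapping.lookup m b))"
    by (cases "Poly_Mapping.lookup m b = 0") (simp_all add: shift del: One_nat_def)
  have right: "Poly_Mapping.single (m + (n - ?e)) (of_nat (Poly_Mapping.lookup n b) :: complex)
      = Poly_Mapping.single (m + n - ?e) (of_nat (Poly_Mapping.lookup n b))"
    by (cases "Poly_Mapping.lookup n b = 0") (simp_all add: shift add.commute[of m] del: One_nat_def)
  show ?thesis
    using left right by (simp add: partial_def mult_single lookup_add single_add)
qed

lemma derivation_partial: "derivation (partial b)"
proof -
  interpret L: Vector_Spaces.linear pscale pscale "partial b"
    unfolding partial_def by (rule linear_lin_ext)
  have lin_l: "Vector_Spaces.linear pscale pscale (\<lambda>f. partial b (f * g))"
    and lin_l': "Vector_Spaces.linear pscale pscale (\<lambda>f. partial b f * g + f * partial b g)"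
    and lin_r: "Vector_Spaces.linear pscale pscale (\<lambda>f. partial b (g * f))"
    and lin_r': "Vector_Spaces.linear pscale pscale (\<lambda>f. partial b g * f + g * partial b f)" for g
  proof -
    have sc: "pscale c f * h = pscale c (f * h)" "h * pscale c f = pscale c (h * f)"
      for c and f h :: poly4
      by (simp_all add: pscale_conv_mult mult_ac)
    show "Vector_Spaces.linear pscale pscale (\<lambda>f. partial b (f * g))"
      "Vector_Spaces.linear pscale pscale (\<lambda>f. partial b f * g + f * partial b g)"
      "Vector_Spaces.linear pscale pscale (\<lambda>f. partial b (g * f))"
      "Vector_Spaces.linear pscale pscale (\<lambda>f. partial b g * f + g * partial b f)"
      by (unfold_locales; simp add: algebra_simps L.add L.scale sc pv.scale_right_distrib)+
  qed
  have "(\<lambda>g. partial b (bvec m * g)) = (\<lambda>g. partial b (bvec m) * g + bvec m * partial b g)"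
    for m
    by (rule linear_eq_on_bvec[OF lin_r lin_r']) (rule partial_monomials)
  then have mono: "partial b (bvec m * g) = partial b (bvec m) * g + bvec m * partial b g" for m g
    by metis
  have "(\<lambda>f. partial b (f * g)) = (\<lambda>f. partial b f * g + f * partial b g)" for g
    by (rule linear_eq_on_bvec[OF lin_l lin_l']) (rule mono)
  then have "partial b (f * g) = partial b f * g + f * partial b g" for f g
    by metis
  then show ?thesis
    unfolding derivation_def using L.linear_axioms by blast
qed

lemma P_act_derivation: "derivation (P_act \<phi>)"
proof -
  have lin: "Vector_Spaces.linear pscale pscale (partial b)"
    and leib: "partial b (f * g) = partial b f * g + f * partial b g" for b f g
    using derivation_partial unfolding derivation_def by blast+
  have add: "partial b (f + g) = partial b f + partial b g"
    and scale: "partial b (pscale c f) = pscale c (partial b f)" for b c f g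
    using lin[of b] by (simp_all add: Vector_Spaces.linear_iff)
  have sc: "h * pscale c f = pscale c (h * f)" for c and f h :: poly4
    by (simp add: pscale_conv_mult mult_ac)
  have "Vector_Spaces.linear pscale pscale (P_act \<phi>)"
    by unfold_locales
      (simp_all add: P_act_def add scale sc distrib_left sum.distrib pv.scale_sum_right)
  moreover have "P_act \<phi> (f * g) = P_act \<phi> f * g + f * P_act \<phi> g" for f g
    by (simp add: P_act_def leib sum_distrib_left sum_distrib_right sum.distrib algebra_simps)
  ultimately show ?thesis
    by (simp add: derivation_def)
qed

lemma P_act_var: "P_act \<phi> (var b) = (\<Sum>a\<in>UNIV. pscale (\<phi> $ a $ b) (var a))"
  by (simp add: P_act_def partial_var if_distrib cong: if_cong)

lemma derivation_eqI:
  assumes D: "derivation D" and E: "derivation E" and eq: "\<And>b. D (var b) = E (var b)"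
  shows "D = E"
proof -
  have leib: "D (f * g) = D f * g + f * D g" "E (f * g) = E f * g + f * E g" for f g
    using D E by (auto simp: derivation_def)
  have one: "D 1 = 0" "E 1 = 0"
    using leib(1)[of 1 1] leib(2)[of 1 1] by simp_all
  have "D (bvec m) = E (bvec m)" for m
  proof (induction "\<Sum>b\<in>UNIV. Poly_Mapping.lookup m b" arbitrary: m rule: less_induct)
    case less
    show ?case
    proof (cases "m = 0")
      case True
      then show ?thesis by (simp add: one)
    next
      case False
      then obtain b where b: "Poly_Mapping.lookup m b \<noteq> 0"
        by (metis poly_mapping_eqI lookup_zero)
      define n where "n = m - Poly_Mapping.single b 1"
      have m: "m = Poly_Mapping.single b 1 + n"
        unfolding n_def using b
        by (intro poly_mapping_eqI) (auto simp: lookup_add lookup_minus lookup_single when_def)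
      have "(\<Sum>c\<in>UNIV. Poly_Mapping.lookup m c)
          = (\<Sum>c\<in>UNIV. (1 when b = c)) + (\<Sum>c\<in>UNIV. Poly_Mapping.lookup n c)"
        by (subst m) (simp add: lookup_add lookup_single sum.distrib)
      then have "D (bvec n) = E (bvec n)"
        by (intro less) (simp add: when_def)
      moreover have "bvec m = var b * bvec n"
        by (simp add: m var_def mult_single)
      ultimately show ?thesis
        by (simp add: leib eq)
    qed
  qed
  then show ?thesis
    by (intro linear_eq_on_bvec) (use D E in \<open>auto simp: derivation_def\<close>)
qed

text \<open>
  Hence \<open>P_act \<phi>\<close> is the unique derivation that acts on the degree-one part by the matrix \<open>\<phi>\<close>.
\<close>

lemma P_act_unique:
  "derivation D \<and> (\<forall>b. D (var b) = (\<Sum>a\<in>UNIV. pscale (\<phi> $ a $ b) (var a))) \<longleftrightarrow> D = P_act \<phi>"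
  using P_act_derivation P_act_var derivation_eqI by metis

section \<open>The hypercube and its subconstituent algebra\<close>

type_synonym vertex = "nat \<Rightarrow> int"

definition cube :: "nat \<Rightarrow> vertex set" where
  "cube N = {1..N} \<rightarrow>\<^sub>E {1, -1}"

definition adj :: "nat \<Rightarrow> (vertex \<times> vertex) set" where
  "adj N = {(x, y). x \<in> cube N \<and> y \<in> cube N \<and> card {i \<in> {1..N}. x i \<noteq> y i} = 1}"

definition gdist :: "nat \<Rightarrow> vertex \<Rightarrow> vertex \<Rightarrow> nat" where
  "gdist N x y = (LEAST n. (x, y) \<in> adj N ^^ n)"

definition Gam :: "nat \<Rightarrow> nat \<Rightarrow> vertex \<Rightarrow> vertex set" where
  "Gam N i x = {y \<in> cube N. gdist N x y = i}"

type_synonym hvec = "vertex \<Rightarrow>\<^sub>0 complex"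

definition Vsp :: "nat \<Rightarrow> hvec set" where
  "Vsp N = {v. Poly_Mapping.keys v \<subseteq> cube N}"

definition herm :: "nat \<Rightarrow> hvec \<Rightarrow> hvec \<Rightarrow> complex" where
  "herm N u v = (\<Sum>x\<in>cube N. Poly_Mapping.lookup u x * cnj (Poly_Mapping.lookup v x))"

text \<open>
  \<open>End(V)\<close> consists of the linear maps with values in \<open>V\<close>, normalised to vanish on the basis
  vectors of the ambient space that are not vertices; so each endomorphism of \<open>V\<close> has exactly one
  representative and its algebra unit is \<open>on_basis N bvec\<close>. Addition is pointwise and
  multiplication is composition.
\<close>

definition EndV :: "nat \<Rightarrow> (hvec \<Rightarrow> hvec) set" where
  "EndV N = {L. Vector_Spaces.linear pscale pscale L \<and> range L \<subseteq> Vsp N \<and>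
                (\<forall>x. x \<notin> cube N \<longrightarrow> L (bvec x) = 0)}"

definition on_basis :: "nat \<Rightarrow> (vertex \<Rightarrow> hvec) \<Rightarrow> hvec \<Rightarrow> hvec" where
  "on_basis N g = lin_ext (\<lambda>x. if x \<in> cube N then g x else 0)"

definition opscale :: "complex \<Rightarrow> (hvec \<Rightarrow> hvec) \<Rightarrow> hvec \<Rightarrow> hvec" where
  "opscale c L = (\<lambda>v. pscale c (L v))"

interpretation opv: vector_space opscale
  by standard (simp_all add: opscale_def fun_eq_iff pv.scale_right_distrib pv.scale_left_distrib)

text \<open>Here \<open>\<theta>\<^sub>i = \<theta>\<^sup>*\<^sub>i\<close>, so a single constant serves for both.\<close>

definition theta :: "nat \<Rightarrow> nat \<Rightarrow> complex" where
  "theta N i = of_nat N - 2 * of_nat i"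

definition Adj :: "nat \<Rightarrow> hvec \<Rightarrow> hvec" where
  "Adj N = on_basis N (\<lambda>x. \<Sum>\<xi> | (x, \<xi>) \<in> adj N. bvec \<xi>)"

definition Ah :: "nat \<Rightarrow> nat \<Rightarrow> hvec \<Rightarrow> hvec" where
  "Ah N h = on_basis N (\<lambda>x. \<Sum>\<xi>\<in>Gam N h x. bvec \<xi>)"

definition eigenspace :: "nat \<Rightarrow> nat \<Rightarrow> hvec set" where
  "eigenspace N i = {v \<in> Vsp N. Adj N v = pscale (theta N i) v}"

text \<open>The projection onto the \<open>i\<close>-th eigenspace along the others; unique as \<open>Adj\<close> is diagonalizable.\<close>

definition Ei :: "nat \<Rightarrow> nat \<Rightarrow> hvec \<Rightarrow> hvec" where
  "Ei N i = (THE E. E \<in> EndV N \<and> (\<forall>v\<in>eigenspace N i. E v = v) \<and>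
                    (\<forall>j\<le>N. j \<noteq> i \<longrightarrow> (\<forall>v\<in>eigenspace N j. E v = 0)))"

definition Adjs :: "nat \<Rightarrow> vertex \<Rightarrow> hvec \<Rightarrow> hvec" where
  "Adjs N \<kappa> = on_basis N (\<lambda>x. pscale (theta N (gdist N x \<kappa>)) (bvec x))"

definition Eis :: "nat \<Rightarrow> vertex \<Rightarrow> nat \<Rightarrow> hvec \<Rightarrow> hvec" where
  "Eis N \<kappa> i = on_basis N (\<lambda>x. if gdist N x \<kappa> = i then bvec x else 0)"

definition Ahs :: "nat \<Rightarrow> vertex \<Rightarrow> nat \<Rightarrow> hvec \<Rightarrow> hvec" where
  "Ahs N \<kappa> h = on_basis N (\<lambda>x. pscale (2 ^ N * herm N (Ei N h (bvec \<kappa>)) (bvec x)) (bvec x))"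

definition subalgebra :: "nat \<Rightarrow> (hvec \<Rightarrow> hvec) set \<Rightarrow> bool" where
  "subalgebra N S \<longleftrightarrow> S \<subseteq> EndV N \<and> module.subspace opscale S \<and> on_basis N bvec \<in> S \<and>
     (\<forall>L\<in>S. \<forall>M\<in>S. L \<circ> M \<in> S)"

definition Talg :: "nat \<Rightarrow> vertex \<Rightarrow> (hvec \<Rightarrow> hvec) set" where
  "Talg N \<kappa> = subalgebra N hull {Adj N, Adjs N \<kappa>}"

definition Pdd :: "nat \<Rightarrow> (nat \<times> nat \<times> nat) set" where
  "Pdd N = {(h, i, j). h \<le> N \<and> i \<le> N \<and> j \<le> N \<and> even (h + i + j) \<and> h + i + j \<le> 2 * N \<and>
                       h \<le> i + j \<and> i \<le> j + h \<and> j \<le> h + i}"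

text \<open>
  The prescription determines the action of \<open>sl4\<close> on \<open>T\<close>, since \<open>A1, A2, A3, A1s, A2s, A3s\<close>
  generate \<open>sl4\<close> and each of the two families below is a basis of \<open>T\<close>.
  In the second family \<open>A2s\<close> goes with \<open>j\<close> and \<open>A3s\<close> with \<open>i\<close>.
\<close>

definition T_action :: "nat \<Rightarrow> vertex \<Rightarrow> (complex^4^4 \<Rightarrow> (hvec \<Rightarrow> hvec) \<Rightarrow> hvec \<Rightarrow> hvec) \<Rightarrow> bool" where
  "T_action N \<kappa> \<rho> \<longleftrightarrow> sl4_module opscale (Talg N \<kappa>) \<rho> \<and>
     (\<forall>(h, i, j)\<in>Pdd N.
        let S = Ei N i \<circ> Ahs N \<kappa> h \<circ> Ei N j in
          \<rho> A1 S = opscale (theta N h) S \<and>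
          \<rho> A2 S = opscale (theta N i) S \<and>
          \<rho> A3 S = opscale (theta N j) S) \<and>
     (\<forall>(h, i, j)\<in>Pdd N.
        let S = Eis N \<kappa> i \<circ> Ah N h \<circ> Eis N \<kappa> j in
          \<rho> A1s S = opscale (theta N h) S \<and>
          \<rho> A2s S = opscale (theta N j) S \<and>
          \<rho> A3s S = opscale (theta N i) S)"

section \<open>The map \<open>\<vartheta>\<close>\<close>

type_synonym hvec3 = "(vertex \<times> vertex \<times> vertex) \<Rightarrow>\<^sub>0 complex"

definition profile :: "nat \<Rightarrow> vertex \<times> vertex \<times> vertex \<Rightarrow> nat \<times> nat \<times> nat \<times> nat" where
  "profile N = (\<lambda>(x, y, z).
     (card {i \<in> {1..N}. x i = y i \<and> y i = z i},
      card {i \<in> {1..N}. x i \<noteq> y i \<and> y i = z i},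
      card {i \<in> {1..N}. y i \<noteq> z i \<and> z i = x i},
      card {i \<in> {1..N}. z i \<noteq> x i \<and> x i = y i}))"

definition Bsum :: "nat \<Rightarrow> nat \<times> nat \<times> nat \<times> nat \<Rightarrow> hvec3" where
  "Bsum N p = (\<Sum>q | q \<in> cube N \<times> cube N \<times> cube N \<and> profile N q = p. bvec q)"

definition Btilde :: "nat \<Rightarrow> nat \<times> nat \<times> nat \<times> nat \<Rightarrow> hvec3" where
  "Btilde N = (\<lambda>(r, s, t, u).
     pscale (fact r * fact s * fact t * fact u / (fact N * 2 ^ N)) (Bsum N (r, s, t, u)))"

definition ddag :: "nat \<Rightarrow> poly4 \<Rightarrow> hvec3" where
  "ddag N = lin_ext (\<lambda>m. pscale (complex_of_real (sqrt (fact N * 2 ^ N)))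
     (Btilde N (Poly_Mapping.lookup m 1, Poly_Mapping.lookup m 2,
                Poly_Mapping.lookup m 3, Poly_Mapping.lookup m 4)))"

definition e_unit :: "nat \<Rightarrow> vertex \<Rightarrow> vertex \<Rightarrow> hvec \<Rightarrow> hvec" where
  "e_unit N x y = on_basis N (\<lambda>z. if z = y then bvec x else 0)"

text \<open>\<open>lin_ext\<close> is not applicable here, as the values are operators.\<close>

definition eps :: "nat \<Rightarrow> vertex \<Rightarrow> hvec3 \<Rightarrow> hvec \<Rightarrow> hvec" where
  "eps N \<kappa> v = (\<Sum>(x, y, z)\<in>cube N \<times> cube N \<times> cube N.
     opscale (Poly_Mapping.lookup v (x, y, z))
       (if x = \<kappa> then opscale (complex_of_real (2 powr (real N / 2))) (e_unit N y z) else 0))"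

definition vtheta :: "nat \<Rightarrow> vertex \<Rightarrow> poly4 \<Rightarrow> hvec \<Rightarrow> hvec" where
  "vtheta N \<kappa> f = eps N \<kappa> (ddag N f)"

end

(*
  Everything is read off matrix entries.  The (y, z) entry of the image of a polynomial f under
  vartheta is, up to a nonzero constant, r! s! t! u! times the coefficient of f at the profile
  (r, s, t, u) of (kappa, y, z).  On these numbers the derivation A1, A2 or A3 becomes the sum over
  all ways of flipping one coordinate of the first, second or third vertex; so A2 and A3 correspond
  to left and right multiplication by the adjacency map, and A1s, A2s, A3s act diagonally.

  The Fourier transform F of the hypercube with origin kappa exchanges A_h with A_h^* and E_i with
  E_i^*, so conjugation by F preserves T and carries one of the two prescribed families to the other.
  As T consists of the operators whose entries depend only on the profile, it is the image of P_N and
  is spanned by the second family, hence also by the first.  An action of sl_4 on T with the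
  prescribed eigenvalues is therefore unique, and the one transported from P_N has these eigenvalues.
*)

theory Submission
  imports Defs "HOL-Combinatorics.Permutations"
begin

section \<open>Operators and their matrix entries\<close>

text \<open>The maps A2 and A3 move a vertex that indexes a row or a column. The obstacle is A1: it
  moves the first vertex away from \<kappa>, while an element of T has entries only for first vertex
  \<kappa>. What helps is that profiles classify triples of vertices up to all isometries of the
  cube, so a function of the profile is known on all triples once it is known for first vertex
  \<kappa>. For E_i A_h^* E_j the extension is explicit: the diagonal of A_h^* is 2^N times a column
  of E_h, so the (y, z) entry is 2^N times the sum over v of E_i(y,v) E_h(v,\<kappa>) E_j(v,z). Here
  \<kappa> may be replaced by any vertex x, and moving x applies the adjacency map to E_h. The
  factors r! s! t! u! turn coefficients into those for divided powers. There v_a d/dv_b multiplies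
  by the exponent of v_a, which counts the coordinates of one type; this is where the sum over
  coordinates comes from.\<close>

abbreviation coeff_at :: "('a \<Rightarrow>\<^sub>0 complex) \<Rightarrow> 'a \<Rightarrow> complex" where
  "coeff_at \<equiv> Poly_Mapping.lookup"

lemma if_times: "(if P then a else 0) * c = (if P then a * c else 0)" for a c :: complex
  by simp

definition entry :: "(hvec \<Rightarrow> hvec) \<Rightarrow> vertex \<Rightarrow> vertex \<Rightarrow> complex" where
  "entry L y z = coeff_at (L (bvec z)) y"

lemma finite_cube [simp]: "finite (cube N)"
  unfolding cube_def by (intro finite_PiE) auto

lemma lookup_lin_ext:
  "coeff_at (lin_ext g f) y = (\<Sum>x\<in>Poly_Mapping.keys f. coeff_at f x * coeff_at (g x) y)"
  by (simp add: lin_ext_def lookup_sum)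

lemma EndV_eq_lin_ext:
  assumes "L \<in> EndV N" shows "L = lin_ext (\<lambda>x. L (bvec x))"
  by (rule linear_eq_on_bvec) (use assms linear_lin_ext in \<open>auto simp: EndV_def\<close>)

lemma EndV_linear: "L \<in> EndV N \<Longrightarrow> Vector_Spaces.linear pscale pscale L"
  by (simp add: EndV_def)

lemma EndV_in_Vsp: "L \<in> EndV N \<Longrightarrow> L v \<in> Vsp N"
  by (auto simp: EndV_def)

lemma Vsp_lookup_eq_0: "v \<in> Vsp N \<Longrightarrow> y \<notin> cube N \<Longrightarrow> coeff_at v y = 0"
  by (metis Vsp_def in_keys_iff mem_Collect_eq subsetD)

lemma Vsp_eqI:
  assumes "u \<in> Vsp N" "v \<in> Vsp N" "\<And>y. y \<in> cube N \<Longrightarrow> coeff_at u y = coeff_at v y"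
  shows "u = v"
  by (rule poly_mapping_eqI) (metis assms Vsp_lookup_eq_0)

lemma bvec_in_Vsp [simp]: "z \<in> cube N \<Longrightarrow> bvec z \<in> Vsp N"
  by (auto simp: Vsp_def)

lemma subspace_Vsp: "pv.subspace (Vsp N)"
  unfolding pv.subspace_def Vsp_def by (auto simp: in_keys_iff subset_iff lookup_add) (metis add_0)

lemma zero_in_Vsp [simp]: "0 \<in> Vsp N"
  by (rule pv.subspace_0[OF subspace_Vsp])

lemma pscale_in_Vsp [simp]: "v \<in> Vsp N \<Longrightarrow> pscale c v \<in> Vsp N"
  by (rule pv.subspace_scale[OF subspace_Vsp])

lemma sum_in_Vsp: "(\<And>i. i \<in> I \<Longrightarrow> f i \<in> Vsp N) \<Longrightarrow> sum f I \<in> Vsp N"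
  by (rule pv.subspace_sum[OF subspace_Vsp])

lemma entry_outside:
  assumes "L \<in> EndV N" "y \<notin> cube N \<or> z \<notin> cube N" shows "entry L y z = 0"
  using assms Vsp_lookup_eq_0[OF EndV_in_Vsp[OF assms(1)]] by (auto simp: entry_def EndV_def)

lemma lookup_EndV:
  assumes L: "L \<in> EndV N"
  shows "coeff_at (L v) y = (\<Sum>z\<in>cube N. coeff_at v z * entry L y z)"
proof -
  have "coeff_at (L v) y = (\<Sum>z\<in>Poly_Mapping.keys v. coeff_at v z * entry L y z)"
    by (subst EndV_eq_lin_ext[OF L]) (simp add: lookup_lin_ext entry_def)
  also have "\<dots> = (\<Sum>z\<in>cube N. coeff_at v z * entry L y z)"
    by (rule sum.mono_neutral_cong) (auto simp: in_keys_iff entry_outside[OF L])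
  finally show ?thesis .
qed

text \<open>The normalisation in \<open>EndV\<close> makes all entries outside the cube vanish, so
  the entries indexed by vertices determine the operator on the ambient space.\<close>

lemma EndV_eqI:
  assumes "L \<in> EndV N" "M \<in> EndV N"
    and "\<And>y z. y \<in> cube N \<Longrightarrow> z \<in> cube N \<Longrightarrow> entry L y z = entry M y z"
  shows "L = M"
proof
  fix v show "L v = M v"
  proof (rule poly_mapping_eqI)
    fix y
    have "entry L y z = entry M y z" if "z \<in> cube N" for z
      using assms that by (cases "y \<in> cube N") (auto simp: entry_outside)
    then show "coeff_at (L v) y = coeff_at (M v) y"
      unfolding lookup_EndV[OF assms(1)] lookup_EndV[OF assms(2)] by simp
  qed
qed

lemma EndV_comp [intro]: "L \<in> EndV N \<Longrightarrow> M \<in> EndV N \<Longrightarrow> L \<circ> M \<in> EndV N"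
  unfolding EndV_def
  using Vector_Spaces.linear_compose[of pscale pscale M pscale L] module_hom.zero[of pscale pscale L]
  by (auto simp: linear_iff_module_hom)

lemma subspace_EndV: "opv.subspace (EndV N)"
  using pv.subspace_add[OF subspace_Vsp]
  unfolding opv.subspace_def EndV_def
  by (simp add: Vector_Spaces.linear_iff opscale_def pv.vector_space_axioms
      pv.scale_right_distrib image_subset_iff pv.scale_left_commute)

lemma EndV_scale [intro]: "L \<in> EndV N \<Longrightarrow> opscale c L \<in> EndV N"
  by (rule opv.subspace_scale[OF subspace_EndV])

lemma entry_comp:
  assumes "L \<in> EndV N"
  shows "entry (L \<circ> M) y z = (\<Sum>w\<in>cube N. entry L y w * entry M w z)"
  unfolding entry_def[of "L \<circ> M"] comp_apply lookup_EndV[OF assms]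
  by (simp add: entry_def mult.commute)

lemma entry_add [simp]: "entry (L + M) y z = entry L y z + entry M y z"
  by (simp add: entry_def lookup_add)

lemma entry_zero [simp]: "entry 0 y z = 0"
  by (simp add: entry_def)

lemma entry_scale [simp]: "entry (opscale c L) y z = c * entry L y z"
  by (simp add: entry_def opscale_def)

lemma entry_sum: "entry (sum f I) y z = (\<Sum>i\<in>I. entry (f i) y z)"
  by (induction I rule: infinite_finite_induct)
    (simp_all only: sum.infinite sum.empty sum.insert entry_add entry_zero not_False_eq_True)

lemma entry_on_basis:
  "entry (on_basis N g) y z = (if z \<in> cube N then coeff_at (g z) y else 0)"
  by (simp add: entry_def on_basis_def)

lemma on_basis_cong:
  assumes "\<And>x. x \<in> cube N \<Longrightarrow> g x = h x" shows "on_basis N g = on_basis N h"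
  unfolding on_basis_def using assms by (intro arg_cong[where f = lin_ext]) auto

lemma on_basis_in_EndV [intro]:
  assumes "\<And>x. x \<in> cube N \<Longrightarrow> g x \<in> Vsp N" shows "on_basis N g \<in> EndV N"
proof -
  have "on_basis N g v \<in> Vsp N" for v
    unfolding on_basis_def lin_ext_def
    by (intro sum_in_Vsp pscale_in_Vsp) (use assms in auto)
  then show ?thesis
    by (auto simp: EndV_def on_basis_def linear_lin_ext)
qed

lemma opscale_comp_left: "opscale c L \<circ> M = opscale c (L \<circ> M)"
  by (simp add: opscale_def fun_eq_iff)

lemma opscale_comp_right: "L \<in> EndV N \<Longrightarrow> L \<circ> opscale c M = opscale c (L \<circ> M)"
  by (simp add: opscale_def fun_eq_iff EndV_def Vector_Spaces.linear_iff)

lemma add_comp_left: "(L + L') \<circ> M = (L \<circ> M) + (L' \<circ> M)"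
  for L L' M :: "hvec \<Rightarrow> hvec"
  by (simp add: fun_eq_iff)

lemma add_comp_right: "L \<in> EndV N \<Longrightarrow> L \<circ> (M + M') = (L \<circ> M) + (L \<circ> M')"
  by (simp add: fun_eq_iff EndV_def Vector_Spaces.linear_iff)

definition id_op :: "nat \<Rightarrow> hvec \<Rightarrow> hvec" where
  "id_op N = on_basis N bvec"

lemma id_op_in_EndV [simp, intro]: "id_op N \<in> EndV N"
  by (auto simp: id_op_def)

lemma entry_id_op: "z \<in> cube N \<Longrightarrow> entry (id_op N) y z = (if y = z then 1 else 0)"
  by (simp add: id_op_def entry_on_basis lookup_single when_def)

lemma EndV_Vsp_id: "v \<in> Vsp N \<Longrightarrow> id_op N v = v"
  by (rule Vsp_eqI[of _ N])
    (auto simp: EndV_in_Vsp lookup_EndV[of _ N] entry_id_op if_distrib cong: if_cong)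

section \<open>Hamming distance\<close>

definition ham :: "nat \<Rightarrow> vertex \<Rightarrow> vertex \<Rightarrow> nat" where
  "ham N x y = card {i \<in> {1..N}. x i \<noteq> y i}"

definition flip :: "nat \<Rightarrow> vertex \<Rightarrow> vertex" where
  "flip k x = x(k := - x k)"

lemma cube_values: "x \<in> cube N \<Longrightarrow> i \<in> {1..N} \<Longrightarrow> x i = 1 \<or> x i = -1"
  unfolding cube_def using PiE_mem[of x "{1..N}" "\<lambda>_. {1, -1}" i] by blast

lemma cube_eqI: "x \<in> cube N \<Longrightarrow> y \<in> cube N \<Longrightarrow> (\<And>i. i \<in> {1..N} \<Longrightarrow> x i = y i) \<Longrightarrow> x = y"
  unfolding cube_def by (rule PiE_ext)

lemma restrict_in_cube: "(\<And>i. i \<in> {1..N} \<Longrightarrow> f i \<in> {1, -1}) \<Longrightarrow> restrict f {1..N} \<in> cube N"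
  unfolding cube_def by auto

lemma ham_commute: "ham N x y = ham N y x"
  unfolding ham_def by (intro arg_cong[where f = card]) auto

lemma ham_le: "ham N x y \<le> N"
  using card_mono[of "{1..N}" "{i \<in> {1..N}. x i \<noteq> y i}"] unfolding ham_def by force

lemma ham_eq_0: "x \<in> cube N \<Longrightarrow> y \<in> cube N \<Longrightarrow> ham N x y = 0 \<longleftrightarrow> x = y"
  unfolding ham_def by (auto intro: cube_eqI)

lemma flip_in_cube [simp]: "k \<in> {1..N} \<Longrightarrow> x \<in> cube N \<Longrightarrow> flip k x \<in> cube N"
  unfolding flip_def cube_def by (auto simp: PiE_iff extensional_def)

lemma ham_flip: "k \<in> {1..N} \<Longrightarrow> x \<in> cube N \<Longrightarrow> ham N x (flip k x) = 1"
proof -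
  assume k: "k \<in> {1..N}" and x: "x \<in> cube N"
  have "{i \<in> {1..N}. x i \<noteq> flip k x i} = {k}"
    using k cube_values[OF x k] by (auto simp: flip_def)
  then show ?thesis by (simp add: ham_def)
qed

lemma inj_on_flip: "x \<in> cube N \<Longrightarrow> inj_on (\<lambda>k. flip k x) {1..N}"
proof (rule inj_onI)
  fix k l assume x: "x \<in> cube N" and k: "k \<in> {1..N}" and eq: "flip k x = flip l x"
  then show "k = l"
    using fun_cong[OF eq[unfolded flip_def], of k] cube_values[OF x k]
    by (auto split: if_splits)
qed

lemma neighbours_eq_flips:
  assumes x: "x \<in> cube N" shows "{y \<in> cube N. ham N x y = 1} = (\<lambda>k. flip k x) ` {1..N}"
proof
  show "{y \<in> cube N. ham N x y = 1} \<subseteq> (\<lambda>k. flip k x) ` {1..N}"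
  proof
    fix y assume "y \<in> {y \<in> cube N. ham N x y = 1}"
    then have y: "y \<in> cube N" and "ham N x y = 1" by auto
    then obtain k where k: "{i \<in> {1..N}. x i \<noteq> y i} = {k}"
      unfolding ham_def by (auto simp: card_1_singleton_iff)
    then have kN: "k \<in> {1..N}" by auto
    have "y = flip k x"
    proof (rule cube_eqI[of _ N])
      fix i assume i: "i \<in> {1..N}"
      show "y i = flip k x i"
        using cube_values[OF x i] cube_values[OF y i] i set_eq_iff[THEN iffD1, OF k, THEN spec[of _ i]]
        by (cases "i = k") (force simp: flip_def)+
    qed (use x y kN in auto)
    then show "y \<in> (\<lambda>k. flip k x) ` {1..N}" using kN by auto
  qed
qed (use x ham_flip in auto)

text \<open>Sums over neighbours come from products with \<open>Adj\<close>, sums over coordinates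
  from the derivations \<open>A1\<close>, \<open>A2\<close>, \<open>A3\<close>; this equation is
  where they meet.\<close>

lemma sum_neighbours:
  assumes "x \<in> cube N"
  shows "(\<Sum>y\<in>cube N. if ham N x y = 1 then f y else 0) = (\<Sum>k\<in>{1..N}. f (flip k x))"
proof -
  have "(\<Sum>y\<in>cube N. if ham N x y = 1 then f y else 0) = sum f {y \<in> cube N. ham N x y = 1}"
    by (simp add: sum.inter_filter)
  also have "\<dots> = (\<Sum>k\<in>{1..N}. f (flip k x))"
    unfolding neighbours_eq_flips[OF assms] by (subst sum.reindex[OF inj_on_flip[OF assms]]) simp
  finally show ?thesis .
qed

lemma ham_triangle: "ham N x z \<le> ham N x y + ham N y z"
proof -
  have "ham N x z \<le> card ({i \<in> {1..N}. x i \<noteq> y i} \<union> {i \<in> {1..N}. y i \<noteq> z i})"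
    unfolding ham_def by (intro card_mono) auto
  also have "\<dots> \<le> ham N x y + ham N y z"
    unfolding ham_def by (rule card_Un_le)
  finally show ?thesis .
qed

lemma in_adj_iff: "(x, y) \<in> adj N \<longleftrightarrow> x \<in> cube N \<and> y \<in> cube N \<and> ham N x y = 1"
  by (simp add: adj_def ham_def)

lemma ham_le_path: "(x, y) \<in> adj N ^^ n \<Longrightarrow> ham N x y \<le> n"
proof (induction n arbitrary: y)
  case 0
  then show ?case by (simp add: ham_def)
next
  case (Suc n)
  then obtain w where "(x, w) \<in> adj N ^^ n" "(w, y) \<in> adj N" by auto
  then show ?case
    using Suc.IH[of w] ham_triangle[of N x y w] by (simp add: in_adj_iff)
qed

text \<open>Flipping a coordinate in which x and y differ is a step along an edge and lowers the
  Hamming distance by one. With the opposite bound \<open>ham_le_path\<close> this identifies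
  \<open>gdist\<close>.\<close>

lemma path_ham: "x \<in> cube N \<Longrightarrow> y \<in> cube N \<Longrightarrow> (x, y) \<in> adj N ^^ ham N x y"
proof (induction "ham N x y" arbitrary: x)
  case 0
  then show ?case by (metis ham_eq_0 relpow_0_I)
next
  case (Suc n)
  let ?D = "{i \<in> {1..N}. x i \<noteq> y i}"
  obtain k where k: "k \<in> ?D"
    using Suc.hyps(2) by (metis (no_types, lifting) card.empty ex_in_conv ham_def nat.distinct(1))
  have kN: "k \<in> {1..N}" using k by simp
  have "{i \<in> {1..N}. flip k x i \<noteq> y i} = ?D - {k}"
    using k cube_values[OF Suc.prems(1) kN] cube_values[OF Suc.prems(2) kN]
    by (auto simp: flip_def)
  then have n: "ham N (flip k x) y = n"
    using k Suc.hyps(2) by (simp add: ham_def)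
  then have "(flip k x, y) \<in> adj N ^^ n"
    using Suc kN by (metis flip_in_cube)
  moreover have "(x, flip k x) \<in> adj N"
    using Suc.prems kN by (simp add: in_adj_iff ham_flip)
  ultimately show ?case
    using Suc.hyps(2) by (metis relpow_Suc_I2)
qed

lemma gdist_eq_ham: "x \<in> cube N \<Longrightarrow> y \<in> cube N \<Longrightarrow> gdist N x y = ham N x y"
  unfolding gdist_def by (rule Least_equality) (auto intro: path_ham ham_le_path)

section \<open>Adjacency, distance and diagonal operators\<close>

lemma Adj_in_EndV [simp, intro]: "Adj N \<in> EndV N"
  unfolding Adj_def by (auto intro!: sum_in_Vsp simp: in_adj_iff)

lemma Ah_in_EndV [simp, intro]: "Ah N h \<in> EndV N"
  unfolding Ah_def by (auto intro!: sum_in_Vsp simp: Gam_def)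

lemma Adjs_in_EndV [simp, intro]: "Adjs N \<kappa> \<in> EndV N"
  unfolding Adjs_def by auto

lemma Eis_in_EndV [simp, intro]: "Eis N \<kappa> i \<in> EndV N"
  unfolding Eis_def by auto

lemma Ahs_in_EndV [simp, intro]: "Ahs N \<kappa> h \<in> EndV N"
  unfolding Ahs_def by auto

lemma entry_Ah:
  assumes "y \<in> cube N" "z \<in> cube N"
  shows "entry (Ah N h) y z = (if ham N y z = h then 1 else 0)"
proof -
  have "Gam N h z = {x \<in> cube N. ham N z x = h}"
    using assms by (auto simp: Gam_def gdist_eq_ham)
  then show ?thesis
    using assms
    by (simp add: Ah_def entry_on_basis lookup_sum lookup_single when_def sum.delta' ham_commute)
qed

lemma Adj_eq_Ah: "Adj N = Ah N 1"
proof -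
  have "{\<xi>. (x, \<xi>) \<in> adj N} = Gam N 1 x" if "x \<in> cube N" for x
    using that by (auto simp: Gam_def gdist_eq_ham in_adj_iff)
  then show ?thesis
    unfolding Adj_def Ah_def by (intro on_basis_cong) simp
qed

lemma entry_Adj:
  "y \<in> cube N \<Longrightarrow> z \<in> cube N \<Longrightarrow> entry (Adj N) y z = (if ham N y z = 1 then 1 else 0)"
  unfolding Adj_eq_Ah by (rule entry_Ah)

definition diag_op :: "nat \<Rightarrow> (vertex \<Rightarrow> complex) \<Rightarrow> hvec \<Rightarrow> hvec" where
  "diag_op N d = on_basis N (\<lambda>x. pscale (d x) (bvec x))"

lemma diag_op_in_EndV [simp, intro]: "diag_op N d \<in> EndV N"
  unfolding diag_op_def by auto

lemma entry_diag_op: "z \<in> cube N \<Longrightarrow> entry (diag_op N d) y z = (if y = z then d z else 0)"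
  by (simp add: diag_op_def entry_on_basis lookup_single when_def)

lemma diag_op_cong: "(\<And>x. x \<in> cube N \<Longrightarrow> d x = d' x) \<Longrightarrow> diag_op N d = diag_op N d'"
  unfolding diag_op_def by (intro on_basis_cong) simp

lemma entry_diag_op_comp:
  "y \<in> cube N \<Longrightarrow> entry (diag_op N d \<circ> L) y z = d y * entry L y z"
  by (simp add: entry_comp[of _ N] entry_diag_op if_times cong: if_cong)

lemma entry_comp_diag_op:
  "L \<in> EndV N \<Longrightarrow> z \<in> cube N \<Longrightarrow> entry (L \<circ> diag_op N d) y z = entry L y z * d z"
  by (simp add: entry_comp entry_diag_op if_distrib cong: if_cong)

lemma diag_op_comp: "diag_op N d \<circ> diag_op N d' = diag_op N (\<lambda>x. d x * d' x)"
  by (rule EndV_eqI[of _ N]) (auto simp: entry_diag_op_comp entry_diag_op)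

lemma Adjs_eq_diag_op:
  "\<kappa> \<in> cube N \<Longrightarrow> Adjs N \<kappa> = diag_op N (\<lambda>x. theta N (ham N x \<kappa>))"
  unfolding Adjs_def diag_op_def by (intro on_basis_cong) (simp add: gdist_eq_ham)

lemma Eis_eq_diag_op:
  "\<kappa> \<in> cube N \<Longrightarrow> Eis N \<kappa> i = diag_op N (\<lambda>x. if ham N x \<kappa> = i then 1 else 0)"
  unfolding Eis_def diag_op_def by (intro on_basis_cong) (simp add: gdist_eq_ham)

text \<open>The Hermitian form against a vertex reads off a coordinate, so the diagonal of A_h^* is
  2^N times the \<kappa> column of E_h. This form later puts E_h on the same footing as E_i and
  E_j.\<close>

lemma Ahs_eq_diag_op: "Ahs N \<kappa> h = diag_op N (\<lambda>x. 2 ^ N * entry (Ei N h) x \<kappa>)"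
proof -
  have "herm N v (bvec x) = coeff_at v x" if "x \<in> cube N" for v x
    using that by (simp add: herm_def lookup_single when_def if_distrib cong: if_cong)
  then show ?thesis
    unfolding Ahs_def diag_op_def by (intro on_basis_cong) (simp add: entry_def)
qed

section \<open>Subalgebras of \<open>End(V)\<close>\<close>

lemma subalgebra_subspace: "subalgebra N S \<Longrightarrow> opv.subspace S"
  by (simp add: subalgebra_def)

lemma subalgebra_EndV: "subalgebra N S \<Longrightarrow> L \<in> S \<Longrightarrow> L \<in> EndV N"
  by (auto simp: subalgebra_def)

lemma subalgebra_id: "subalgebra N S \<Longrightarrow> id_op N \<in> S"
  by (simp add: subalgebra_def id_op_def)

lemma subalgebra_comp: "subalgebra N S \<Longrightarrow> L \<in> S \<Longrightarrow> M \<in> S \<Longrightarrow> L \<circ> M \<in> S"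
  by (simp add: subalgebra_def)

lemma subalgebra_add: "subalgebra N S \<Longrightarrow> L \<in> S \<Longrightarrow> M \<in> S \<Longrightarrow> L + M \<in> S"
  by (rule opv.subspace_add[OF subalgebra_subspace])

lemma subalgebra_scale: "subalgebra N S \<Longrightarrow> L \<in> S \<Longrightarrow> opscale c L \<in> S"
  by (rule opv.subspace_scale[OF subalgebra_subspace])

lemma subalgebra_Talg:
  assumes "\<kappa> \<in> cube N" shows "subalgebra N (Talg N \<kappa>)"
proof -
  have E: "subalgebra N (EndV N)"
    unfolding subalgebra_def using subspace_EndV id_op_in_EndV[of N] by (auto simp: id_op_def)
  define F where "F = {S. subalgebra N S \<and> {Adj N, Adjs N \<kappa>} \<subseteq> S}"
  have T: "Talg N \<kappa> = \<Inter> F"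
    unfolding Talg_def hull_def F_def ..
  have "EndV N \<in> F"
    unfolding F_def using E by simp
  moreover have "opv.subspace (\<Inter> F)"
    by (rule opv.subspace_Inter) (auto simp: F_def subalgebra_def)
  ultimately show ?thesis
    unfolding T subalgebra_def by (auto simp: F_def subalgebra_def)
qed

lemma Talg_generators: "Adj N \<in> Talg N \<kappa>" "Adjs N \<kappa> \<in> Talg N \<kappa>"
  unfolding Talg_def using hull_subset[of "{Adj N, Adjs N \<kappa>}" "subalgebra N"] by auto

lemma Talg_minimal: "subalgebra N S \<Longrightarrow> Adj N \<in> S \<Longrightarrow> Adjs N \<kappa> \<in> S \<Longrightarrow> Talg N \<kappa> \<subseteq> S"
  unfolding Talg_def by (intro hull_minimal) auto

text \<open>These are the operators that commute with the permutation g of the vertices. Closure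
  under composition comes from reindexing the middle vertex by g.\<close>

lemma subalgebra_invariant_entries:
  assumes g: "bij_betw g (cube N) (cube N)"
  shows "subalgebra N {L \<in> EndV N. \<forall>y\<in>cube N. \<forall>z\<in>cube N. entry L (g y) (g z) = entry L y z}"
    (is "subalgebra N ?S")
proof -
  have gc: "g y \<in> cube N" if "y \<in> cube N" for y
    using bij_betwE[OF g] that by blast
  have inj: "g y = g z \<longleftrightarrow> y = z" if "y \<in> cube N" "z \<in> cube N" for y z
    using bij_betw_imp_inj_on[OF g] that by (auto dest: inj_onD)
  have comp: "L \<circ> M \<in> ?S" if L: "L \<in> ?S" and M: "M \<in> ?S" for L M
  proof -
    have LE: "L \<in> EndV N" and ME: "M \<in> EndV N" using L M by auto
    have "entry (L \<circ> M) (g y) (g z) = entry (L \<circ> M) y z" if "y \<in> cube N" "z \<in> cube N" for y z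
    proof -
      have "(\<Sum>w\<in>cube N. entry L (g y) w * entry M w (g z))
          = (\<Sum>w\<in>cube N. entry L (g y) (g w) * entry M (g w) (g z))"
        by (rule sum.reindex_bij_betw[OF g, symmetric])
      also have "\<dots> = (\<Sum>w\<in>cube N. entry L y w * entry M w z)"
        using L M that by (intro sum.cong) auto
      finally show ?thesis by (simp add: entry_comp[OF LE])
    qed
    then show ?thesis using EndV_comp[OF LE ME] by simp
  qed
  have "opv.subspace ?S"
    using subspace_EndV unfolding opv.subspace_def by simp
  then show ?thesis
    unfolding subalgebra_def id_op_def[symmetric]
    using comp by (auto simp: entry_id_op gc inj)
qed

lemma theta_eq_iff [simp]: "theta N i = theta N j \<longleftrightarrow> i = j"
  by (simp add: theta_def)

lemma lookup_diag_op: "y \<in> cube N \<Longrightarrow> coeff_at (diag_op N d v) y = d y * coeff_at v y"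
proof -
  assume y: "y \<in> cube N"
  have "coeff_at (diag_op N d v) y = (\<Sum>z\<in>cube N. if y = z then coeff_at v z * d z else 0)"
    unfolding lookup_EndV[OF diag_op_in_EndV]
    by (intro sum.cong) (auto simp: entry_diag_op)
  then show ?thesis using y by simp
qed

lemma diag_op_affine:
  "diag_op N (\<lambda>x. a * (d x + b)) = opscale a (diag_op N d + opscale b (id_op N))"
  by (rule EndV_eqI[of _ N])
    (auto intro!: EndV_scale opv.subspace_add[OF subspace_EndV]
      simp: entry_diag_op entry_id_op simp del: plus_fun_apply)

lemma EndV_eqI_bvec:
  assumes "L \<in> EndV N" "M \<in> EndV N" "\<And>z. z \<in> cube N \<Longrightarrow> L (bvec z) = M (bvec z)"
  shows "L = M"
  using assms by (intro EndV_eqI[of L N M]) (auto simp: entry_def)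

locale base_vertex =
  fixes N :: nat and \<kappa> :: vertex
  assumes base_in_cube: "\<kappa> \<in> cube N"
begin

lemma diag_Eis: "Eis N \<kappa> i = diag_op N (\<lambda>x. if ham N x \<kappa> = i then 1 else 0)"
  by (rule Eis_eq_diag_op[OF base_in_cube])

lemma diag_Adjs: "Adjs N \<kappa> = diag_op N (\<lambda>x. theta N (ham N x \<kappa>))"
  by (rule Adjs_eq_diag_op[OF base_in_cube])

text \<open>By Lagrange interpolation, \<open>Eis i\<close> is a polynomial in \<open>Adjs\<close>.\<close>

lemma Eis_in_subalgebra:
  assumes S: "subalgebra N S" and A: "Adjs N \<kappa> \<in> S"
  shows "Eis N \<kappa> i \<in> S"
proof -
  \<comment> \<open>The factor for node j of the Lagrange polynomial belonging to node i, evaluated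
    at \<open>theta N h\<close>.\<close>
  define q where "q j h = (theta N h - theta N j) * inverse (theta N i - theta N j)" for j h
  have factor: "diag_op N (\<lambda>x. q j (ham N x \<kappa>)) \<in> S" for j
  proof -
    have "diag_op N (\<lambda>x. q j (ham N x \<kappa>))
        = opscale (inverse (theta N i - theta N j)) (Adjs N \<kappa> + opscale (- theta N j) (id_op N))"
      unfolding diag_Adjs diag_op_affine[symmetric] by (simp add: q_def mult.commute)
    then show ?thesis
      using S A by (simp only: subalgebra_scale subalgebra_add subalgebra_id)
  qed
  have "diag_op N (\<lambda>x. \<Prod>j\<in>J. q j (ham N x \<kappa>)) \<in> S" if "finite J" for J
    using that
  proof (induction J)
    case empty
    have "diag_op N (\<lambda>x. 1) = id_op N"
      by (rule EndV_eqI[of _ N]) (auto simp: entry_diag_op entry_id_op)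
    then show ?case using subalgebra_id[OF S] by simp
  next
    case (insert j J)
    then show ?case
      using subalgebra_comp[OF S factor[of j] insert.IH] by (simp add: diag_op_comp)
  qed
  \<comment> \<open>At distance d \<noteq> i the factor for j = d vanishes, at d = i all factors are
    1. For i > N nothing is removed from {..N}, and both sides are 0.\<close>
  moreover have "Eis N \<kappa> i = diag_op N (\<lambda>x. \<Prod>j\<in>{..N} - {i}. q j (ham N x \<kappa>))"
    unfolding diag_Eis
  proof (rule diag_op_cong)
    fix x
    show "(if ham N x \<kappa> = i then 1 else 0) = (\<Prod>j\<in>{..N} - {i}. q j (ham N x \<kappa>))"
      using ham_le[of N x \<kappa>]
      by (auto simp: q_def intro!: prod.neutral[symmetric] prod_zero[symmetric])
  qed
  ultimately show ?thesis by simp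
qed

section \<open>The Fourier transform of the hypercube\<close>

text \<open>The sign (-1)^k, where k counts the coordinates in which x and y both differ from
  \<kappa>: the character table of (Z/2)^N with \<kappa> as neutral element.\<close>

definition chi :: "vertex \<Rightarrow> vertex \<Rightarrow> complex" where
  "chi x y = (\<Prod>i\<in>{1..N}. if x i = \<kappa> i \<or> y i = \<kappa> i then 1 else -1)"

definition fourier :: "hvec \<Rightarrow> hvec" where
  "fourier = on_basis N (\<lambda>z. \<Sum>y\<in>cube N. pscale (chi y z) (bvec y))"

text \<open>Since \<open>fourier\<close> squares to 2^N on V, the factor 1/2^N makes this
  conjugation by \<open>fourier\<close>.\<close>

definition dual :: "(hvec \<Rightarrow> hvec) \<Rightarrow> hvec \<Rightarrow> hvec" where
  "dual L = opscale (1 / 2 ^ N) (fourier \<circ> L \<circ> fourier)"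

lemma chi_commute: "chi x y = chi y x"
  unfolding chi_def by (simp add: disj_commute)

lemma chi_base [simp]: "chi y \<kappa> = 1" "chi \<kappa> y = 1"
  unfolding chi_def by simp_all

text \<open>Both characters are products over coordinates, so the sum over the cube factors into
  sums over {1, -1}; a coordinate where y and z agree gives 2, any other gives 0.\<close>

lemma chi_orthogonal:
  assumes y: "y \<in> cube N" and z: "z \<in> cube N"
  shows "(\<Sum>w\<in>cube N. chi y w * chi w z) = (if y = z then 2 ^ N else 0)"
proof -
  define f where "f i a = (if y i = \<kappa> i \<or> a = \<kappa> i then 1 else -1 :: complex)
      * (if a = \<kappa> i \<or> z i = \<kappa> i then 1 else -1)" for i a
  have "(\<Sum>w\<in>cube N. chi y w * chi w z) = (\<Sum>w\<in>cube N. \<Prod>i\<in>{1..N}. f i (w i))"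
    by (simp add: chi_def f_def prod.distrib)
  also have "\<dots> = (\<Prod>i\<in>{1..N}. \<Sum>a\<in>{1, -1}. f i a)"
    unfolding cube_def by (rule prod_sum_PiE[symmetric]) auto
  also have "\<dots> = (\<Prod>i\<in>{1..N}. if y i = z i then 2 else 0)"
  proof (rule prod.cong)
    fix i assume i: "i \<in> {1..N}"
    show "(\<Sum>a\<in>{1, -1}. f i a) = (if y i = z i then 2 else 0)"
      using cube_values[OF y i] cube_values[OF z i] cube_values[OF base_in_cube i]
      by (elim disjE) (simp_all add: f_def)
  qed simp
  also have "\<dots> = (if y = z then 2 ^ N else 0)"
  proof (cases "y = z")
    case False
    then obtain i where "i \<in> {1..N}" "y i \<noteq> z i" using cube_eqI[OF y z] by blast
    then show ?thesis using False by (auto intro!: prod_zero)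
  qed simp
  finally show ?thesis .
qed

lemma fourier_in_EndV [simp, intro]: "fourier \<in> EndV N"
  unfolding fourier_def by (auto intro!: sum_in_Vsp)

lemma entry_fourier: "y \<in> cube N \<Longrightarrow> z \<in> cube N \<Longrightarrow> entry fourier y z = chi y z"
  by (simp add: fourier_def entry_on_basis lookup_sum lookup_single when_def if_distrib cong: if_cong)

lemma EndV_scaleD: "L \<in> EndV N \<Longrightarrow> L (pscale c v) = pscale c (L v)"
  by (simp add: EndV_def Vector_Spaces.linear_iff)

lemma fourier_fourier: "v \<in> Vsp N \<Longrightarrow> fourier (fourier v) = pscale (2 ^ N) v"
proof -
  assume v: "v \<in> Vsp N"
  have "fourier \<circ> fourier = opscale (2 ^ N) (id_op N)"
    by (rule EndV_eqI[of _ N])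
      (auto simp: entry_comp[of _ N] entry_fourier entry_id_op chi_orthogonal)
  then have "(fourier \<circ> fourier) v = opscale (2 ^ N) (id_op N) v" by simp
  then show ?thesis by (simp add: opscale_def EndV_Vsp_id[OF v])
qed

lemma dual_apply: "dual L v = pscale (1 / 2 ^ N) (fourier (L (fourier v)))"
  by (simp add: dual_def opscale_def)

lemma dual_in_EndV [simp, intro]: "L \<in> EndV N \<Longrightarrow> dual L \<in> EndV N"
  unfolding dual_def by (intro EndV_scale EndV_comp) auto

lemma dual_fourier: "L \<in> EndV N \<Longrightarrow> v \<in> Vsp N \<Longrightarrow> dual L (fourier v) = fourier (L v)"
  by (simp add: dual_apply fourier_fourier EndV_scaleD[of _] EndV_scaleD[OF fourier_in_EndV])

lemma fourier_dual: "L \<in> EndV N \<Longrightarrow> fourier (dual L v) = L (fourier v)"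
  by (simp add: dual_apply EndV_scaleD[OF fourier_in_EndV] fourier_fourier EndV_in_Vsp)

lemma dual_dual: "L \<in> EndV N \<Longrightarrow> dual (dual L) = L"
proof (rule EndV_eqI_bvec[of _ N])
  fix z assume L: "L \<in> EndV N" and z: "z \<in> cube N"
  have "dual (dual L) (bvec z) = pscale (1 / 2 ^ N) (L (fourier (fourier (bvec z))))"
    unfolding dual_apply[of "dual L"] fourier_dual[OF L] ..
  then show "dual (dual L) (bvec z) = L (bvec z)"
    using z L by (simp add: fourier_fourier EndV_scaleD)
qed auto

lemma dual_comp: "L \<in> EndV N \<Longrightarrow> M \<in> EndV N \<Longrightarrow> dual (L \<circ> M) = dual L \<circ> dual M"
  unfolding fun_eq_iff comp_apply
  by (simp add: dual_apply[of L] fourier_dual) (simp add: dual_apply)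

lemma dual_add: "L \<in> EndV N \<Longrightarrow> M \<in> EndV N \<Longrightarrow> dual (L + M) = dual L + dual M"
  unfolding dual_def add_comp_left
  by (simp add: o_assoc[symmetric] add_comp_right[OF fourier_in_EndV] add_comp_left
      opv.scale_right_distrib del: plus_fun_apply)

lemma dual_scale: "dual (opscale c L) = opscale c (dual L)"
  unfolding dual_def opscale_comp_left opscale_comp_right[OF fourier_in_EndV]
  by (simp add: mult.commute)

lemma dual_id: "dual (id_op N) = id_op N"
  by (rule EndV_eqI_bvec[of _ N])
    (auto simp: dual_apply EndV_Vsp_id EndV_in_Vsp fourier_fourier)

text \<open>Preimage of a subalgebra under an algebra automorphism. It turns facts about subalgebras
  containing \<open>Adjs\<close> into facts about those containing \<open>Adj\<close>.\<close>

lemma subalgebra_dual: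
  assumes S: "subalgebra N S" shows "subalgebra N {L \<in> EndV N. dual L \<in> S}"
proof -
  have "dual 0 = 0" using dual_scale[of 0 0] by simp
  then have "opv.subspace {L \<in> EndV N. dual L \<in> S}"
    using subspace_EndV subalgebra_subspace[OF S]
    unfolding opv.subspace_def by (simp add: dual_add dual_scale del: plus_fun_apply)
  then show ?thesis
    unfolding subalgebra_def id_op_def[symmetric]
    using S by (auto simp: dual_comp dual_id subalgebra_comp subalgebra_id)
qed

text \<open>The eigenvalue of A_h on the character of y: the Krawtchouk polynomial of degree h at
  the distance of y from \<kappa>. That only this distance matters is shown in
  \<open>lam_eq\<close>.\<close>

definition lam :: "nat \<Rightarrow> vertex \<Rightarrow> complex" where
  "lam h y = (\<Sum>w\<in>cube N. if ham N w \<kappa> = h then chi w y else 0)"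

text \<open>
  With \<open>\<kappa>\<close> as neutral element the cube is an elementary abelian 2-group, with characters
  \<open>\<lambda>x. chi x y\<close>; these are the eigenvectors of every \<open>Ah\<close>.
\<close>

lemma sum_sphere_chi:
  assumes x: "x \<in> cube N"
  shows "(\<Sum>u\<in>cube N. if ham N x u = h then chi u y else 0) = chi x y * lam h y"
proof -
  \<comment> \<open>Translation by x in the group with neutral element \<kappa>, an involution of
    the cube; it moves the sphere around x to the sphere around \<kappa>.\<close>
  define t where "t u = restrict (\<lambda>i. \<kappa> i * x i * u i) {1..N}" for u :: vertex
  have t: "t u \<in> cube N" if "u \<in> cube N" for u
    unfolding t_def
  proof (rule restrict_in_cube)
    fix i assume i: "i \<in> {1..N}"
    show "\<kappa> i * x i * u i \<in> {1, -1}"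
      using cube_values[OF x i] cube_values[OF that i] cube_values[OF base_in_cube i]
      by (elim disjE) simp_all
  qed
  have tt: "t (t u) = u" if "u \<in> cube N" for u
  proof (rule cube_eqI[of _ N])
    fix i assume i: "i \<in> {1..N}"
    show "t (t u) i = u i"
      using cube_values[OF x i] cube_values[OF that i] cube_values[OF base_in_cube i]
      by (elim disjE) (use i in \<open>simp_all add: t_def\<close>)
  qed (use that t in auto)
  have "(\<Sum>u\<in>cube N. if ham N x u = h then chi u y else 0)
      = (\<Sum>w\<in>cube N. chi x y * (if ham N w \<kappa> = h then chi w y else 0))"
  proof (rule sum.reindex_bij_witness[of _ t t])
    fix u assume u: "u \<in> cube N"
    have "t u i \<noteq> \<kappa> i \<longleftrightarrow> x i \<noteq> u i" if i: "i \<in> {1..N}" for i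
      using cube_values[OF x i] cube_values[OF u i] cube_values[OF base_in_cube i]
      by (elim disjE) (use i in \<open>simp_all add: t_def\<close>)
    then have "ham N (t u) \<kappa> = ham N x u"
      unfolding ham_def by (intro arg_cong[where f = card]) auto
    moreover have "chi u y = chi x y * chi (t u) y"
      unfolding chi_def prod.distrib[symmetric]
    proof (rule prod.cong)
      fix i assume i: "i \<in> {1..N}"
      show "(if u i = \<kappa> i \<or> y i = \<kappa> i then 1 else -1 :: complex)
        = (if x i = \<kappa> i \<or> y i = \<kappa> i then 1 else -1)
          * (if t u i = \<kappa> i \<or> y i = \<kappa> i then 1 else -1)"
        using cube_values[OF x i] cube_values[OF u i] cube_values[OF base_in_cube i]
        by (elim disjE) (use i in \<open>simp_all add: t_def\<close>)
    qed simp
    ultimately show "chi x y * (if ham N (t u) \<kappa> = h then chi (t u) y else 0)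
      = (if ham N x u = h then chi u y else 0)"
      by simp
  qed (use t tt in auto)
  then show ?thesis
    by (simp add: lam_def sum_distrib_left)
qed

lemma Ah_fourier: "Ah N h \<circ> fourier = fourier \<circ> diag_op N (lam h)"
proof (rule EndV_eqI[of _ N])
  fix y z assume yz: "y \<in> cube N" "z \<in> cube N"
  have "entry (Ah N h \<circ> fourier) y z = (\<Sum>u\<in>cube N. if ham N y u = h then chi u z else 0)"
    unfolding entry_comp[OF Ah_in_EndV]
    by (intro sum.cong) (auto simp: entry_Ah entry_fourier yz)
  then show "entry (Ah N h \<circ> fourier) y z = entry (fourier \<circ> diag_op N (lam h)) y z"
    using yz by (simp add: sum_sphere_chi entry_comp_diag_op entry_fourier)
qed auto

lemma dual_Ah: "dual (Ah N h) = diag_op N (lam h)"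
proof (rule EndV_eqI_bvec[of _ N])
  fix z assume "z \<in> cube N"
  then show "dual (Ah N h) (bvec z) = diag_op N (lam h) (bvec z)"
    using fun_cong[OF Ah_fourier[of h], of "bvec z"]
    by (simp add: dual_apply fourier_fourier EndV_in_Vsp)
qed auto

lemma chi_flip:
  assumes k: "k \<in> {1..N}" shows "chi (flip k \<kappa>) y = (if y k = \<kappa> k then 1 else -1)"
proof -
  have "chi (flip k \<kappa>) y = (\<Prod>i\<in>{1..N}. if i = k then (if y k = \<kappa> k then 1 else -1) else 1)"
    unfolding chi_def using cube_values[OF base_in_cube k]
    by (intro prod.cong) (auto simp: flip_def)
  then show ?thesis using k by simp
qed

text \<open>The neighbours of \<kappa> are its N flips, and flip k contributes -1 exactly if y
  differs from \<kappa> in coordinate k. So the eigenvalues of \<open>Adj\<close> are the diagonal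
  entries of \<open>Adjs\<close>.\<close>

lemma lam_1: "lam 1 y = theta N (ham N y \<kappa>)"
proof -
  have "lam 1 y = (\<Sum>w\<in>cube N. if ham N \<kappa> w = 1 then chi w y else 0)"
    by (simp add: lam_def ham_commute)
  also have "\<dots> = (\<Sum>k\<in>{1..N}. chi (flip k \<kappa>) y)"
    by (rule sum_neighbours[OF base_in_cube])
  also have "\<dots> = (\<Sum>k\<in>{1..N}. 1 - 2 * (if y k \<noteq> \<kappa> k then 1 else 0))"
    by (intro sum.cong) (auto simp: chi_flip simp del: One_nat_def)
  also have "\<dots> = of_nat N - 2 * (\<Sum>k\<in>{1..N}. if y k \<noteq> \<kappa> k then 1 else 0)"
    by (simp add: sum_subtractf sum_distrib_left)
  also have "(\<Sum>k\<in>{1..N}. if y k \<noteq> \<kappa> k then 1 else 0) = (of_nat (ham N y \<kappa>) :: complex)"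
    by (simp add: ham_def sum.inter_filter[symmetric])
  finally show ?thesis by (simp add: theta_def)
qed

lemma dual_Adj: "dual (Adj N) = Adjs N \<kappa>"
  unfolding Adj_eq_Ah dual_Ah diag_Adjs by (rule diag_op_cong) (rule lam_1)

lemma dual_Adjs: "dual (Adjs N \<kappa>) = Adj N"
  using dual_dual[OF Adj_in_EndV] by (simp add: dual_Adj)

text \<open>The Fourier transform of v is an eigenvector of \<open>Adjs\<close>, which takes
  different values on different spheres around \<kappa>; so it is supported on sphere j, and E_i^*
  keeps or kills it.\<close>

lemma dual_Eis_eigenvector:
  assumes "v \<in> eigenspace N j"
  shows "dual (Eis N \<kappa> i) v = (if j = i then v else 0)"
proof -
  have v: "v \<in> Vsp N" and ev: "Adj N v = pscale (theta N j) v"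
    using assms by (auto simp: eigenspace_def)
  have A: "Adjs N \<kappa> (fourier v) = pscale (theta N j) (fourier v)"
    using dual_fourier[OF Adj_in_EndV v] by (simp add: dual_Adj ev EndV_scaleD[OF fourier_in_EndV])
  have supp: "coeff_at (fourier v) y = 0" if y: "y \<in> cube N" "ham N y \<kappa> \<noteq> j" for y
  proof -
    have "theta N (ham N y \<kappa>) * coeff_at (fourier v) y = theta N j * coeff_at (fourier v) y"
      using arg_cong[OF A, of "\<lambda>u. coeff_at u y"] y by (simp add: diag_Adjs lookup_diag_op)
    then show ?thesis using y by simp
  qed
  have "Eis N \<kappa> i (fourier v) = (if j = i then fourier v else 0)"
    by (rule Vsp_eqI[of _ N]) (auto simp: EndV_in_Vsp diag_Eis lookup_diag_op supp)
  then show ?thesis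
    using module_hom.zero[OF EndV_linear[OF fourier_in_EndV, unfolded linear_iff_module_hom]] v
    by (simp add: dual_apply fourier_fourier)
qed

lemma fourier_bvec_eigenspace: "w \<in> cube N \<Longrightarrow> fourier (bvec w) \<in> eigenspace N (ham N w \<kappa>)"
proof -
  assume w: "w \<in> cube N"
  have "Adjs N \<kappa> (bvec w) = pscale (theta N (ham N w \<kappa>)) (bvec w)"
    unfolding diag_Adjs using w by (simp add: diag_op_def on_basis_def)
  then have "Adj N (fourier (bvec w)) = pscale (theta N (ham N w \<kappa>)) (fourier (bvec w))"
    using fourier_dual[OF Adjs_in_EndV, of \<kappa> "fourier (bvec w)"] dual_fourier[OF Adjs_in_EndV, of "bvec w" \<kappa>] w
    by (simp add: dual_Adjs EndV_scaleD[OF fourier_in_EndV])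
  then show ?thesis by (simp add: eigenspace_def EndV_in_Vsp)
qed

text \<open>Existence is the behaviour on eigenvectors just shown. Uniqueness holds because the
  Fourier transforms of the vertices are eigenvectors and span V.\<close>

lemma Ei_eq_dual: "Ei N i = dual (Eis N \<kappa> i)"
  unfolding Ei_def
proof (rule the_equality)
  show "dual (Eis N \<kappa> i) \<in> EndV N \<and> (\<forall>v\<in>eigenspace N i. dual (Eis N \<kappa> i) v = v) \<and>
      (\<forall>j\<le>N. j \<noteq> i \<longrightarrow> (\<forall>v\<in>eigenspace N j. dual (Eis N \<kappa> i) v = 0))"
    by (simp add: dual_Eis_eigenvector)
next
  fix E assume E: "E \<in> EndV N \<and> (\<forall>v\<in>eigenspace N i. E v = v) \<and>
      (\<forall>j\<le>N. j \<noteq> i \<longrightarrow> (\<forall>v\<in>eigenspace N j. E v = 0))"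
  have "E (fourier (bvec w)) = dual (Eis N \<kappa> i) (fourier (bvec w))" if w: "w \<in> cube N" for w
    using E fourier_bvec_eigenspace[OF w] dual_Eis_eigenvector[OF fourier_bvec_eigenspace[OF w], of i]
      ham_le[of N w \<kappa>] by (cases "ham N w \<kappa> = i") auto
  then have "E \<circ> fourier = dual (Eis N \<kappa> i) \<circ> fourier"
    using E by (intro EndV_eqI_bvec[of _ N]) auto
  then have *: "E (fourier v) = dual (Eis N \<kappa> i) (fourier v)" for v
    by (metis comp_apply)
  show "E = dual (Eis N \<kappa> i)"
  proof (rule EndV_eqI_bvec[of _ N])
    fix z assume "z \<in> cube N"
    then have "pscale (2 ^ N) (E (bvec z)) = pscale (2 ^ N) (dual (Eis N \<kappa> i) (bvec z))"
      using *[of "fourier (bvec z)"] E EndV_scaleD[OF dual_in_EndV[OF Eis_in_EndV]]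
      by (simp add: fourier_fourier EndV_scaleD)
    then show "E (bvec z) = dual (Eis N \<kappa> i) (bvec z)" by simp
  qed (use E in auto)
qed

lemma Ei_in_EndV [simp, intro]: "Ei N i \<in> EndV N"
  by (simp add: Ei_eq_dual)

lemma entry_Ei:
  assumes "y \<in> cube N" "z \<in> cube N"
  shows "entry (Ei N i) y z
    = (\<Sum>w\<in>cube N. if ham N w \<kappa> = i then chi y w * chi w z else 0) / 2 ^ N"
proof -
  have "entry (fourier \<circ> diag_op N d \<circ> fourier) y z = (\<Sum>w\<in>cube N. chi y w * d w * chi w z)" for d
    unfolding entry_comp[OF EndV_comp[OF fourier_in_EndV diag_op_in_EndV]]
    using assms by (intro sum.cong) (auto simp: entry_comp_diag_op entry_fourier)
  then show ?thesis
    unfolding Ei_eq_dual dual_def diag_Eis by simp (intro sum.cong, auto)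
qed

text \<open>Self-duality of the cube: as \<open>chi w \<kappa>\<close> is 1, the \<kappa> column of
  E_h is \<open>lam h\<close> over 2^N, so the diagonal of A_h^* lists the eigenvalues of
  A_h.\<close>

lemma diag_Ahs: "Ahs N \<kappa> h = diag_op N (lam h)"
  unfolding Ahs_eq_diag_op
  by (rule diag_op_cong) (simp add: entry_Ei base_in_cube lam_def chi_commute cong: if_cong)

lemma dual_Ahs: "dual (Ahs N \<kappa> h) = Ah N h"
  unfolding diag_Ahs dual_Ah[symmetric] by (rule dual_dual) auto

lemma Adj_Ei: "Adj N \<circ> Ei N i = opscale (theta N i) (Ei N i)"
  and Ei_Adj: "Ei N i \<circ> Adj N = opscale (theta N i) (Ei N i)"
proof -
  have "Adjs N \<kappa> \<circ> Eis N \<kappa> i = opscale (theta N i) (Eis N \<kappa> i)"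
    "Eis N \<kappa> i \<circ> Adjs N \<kappa> = opscale (theta N i) (Eis N \<kappa> i)"
    by (auto intro!: EndV_eqI[of _ N]
        simp: diag_Adjs diag_Eis diag_op_comp entry_diag_op)
  then show "Adj N \<circ> Ei N i = opscale (theta N i) (Ei N i)"
    "Ei N i \<circ> Adj N = opscale (theta N i) (Ei N i)"
    unfolding Ei_eq_dual dual_Adjs[symmetric] by (simp_all add: dual_comp[symmetric] dual_scale)
qed

lemma dual_family: "dual (Eis N \<kappa> i \<circ> Ah N h \<circ> Eis N \<kappa> j) = Ei N i \<circ> Ahs N \<kappa> h \<circ> Ei N j"
  by (simp add: dual_comp EndV_comp Ei_eq_dual dual_Ah diag_Ahs)

lemma dual_Talg: "L \<in> Talg N \<kappa> \<Longrightarrow> dual L \<in> Talg N \<kappa>"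
  using Talg_minimal[OF subalgebra_dual[OF subalgebra_Talg[OF base_in_cube]], of \<kappa>]
    Talg_generators[of N \<kappa>]
  by (auto simp: dual_Adj dual_Adjs)

lemma Ei_in_subalgebra:
  assumes S: "subalgebra N S" and A: "Adj N \<in> S" shows "Ei N i \<in> S"
  using Eis_in_subalgebra[OF subalgebra_dual[OF S], of i] A by (simp add: Ei_eq_dual dual_Adjs)

text \<open>The isometry may move \<kappa>: E_i lies in every subalgebra containing
  \<open>Adj\<close>, in particular in that of the operators invariant under g. The case
  \<open>A1\<close> depends on this freedom.\<close>

lemma entry_Ei_invariant:
  assumes g: "bij_betw g (cube N) (cube N)"
    and ham_g: "\<And>y z. y \<in> cube N \<Longrightarrow> z \<in> cube N \<Longrightarrow> ham N (g y) (g z) = ham N y z"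
    and "y \<in> cube N" "z \<in> cube N"
  shows "entry (Ei N i) (g y) (g z) = entry (Ei N i) y z"
proof -
  have "Adj N \<in> {L \<in> EndV N. \<forall>y\<in>cube N. \<forall>z\<in>cube N. entry L (g y) (g z) = entry L y z}"
    using bij_betwE[OF g] by (auto simp: entry_Adj ham_g)
  from Ei_in_subalgebra[OF subalgebra_invariant_entries[OF g] this] show ?thesis
    using assms by auto
qed

lemma entry_Talg_invariant:
  assumes g: "bij_betw g (cube N) (cube N)"
    and ham_g: "\<And>y z. y \<in> cube N \<Longrightarrow> z \<in> cube N \<Longrightarrow> ham N (g y) (g z) = ham N y z"
    and base: "g \<kappa> = \<kappa>" and L: "L \<in> Talg N \<kappa>" and yz: "y \<in> cube N" "z \<in> cube N"
  shows "entry L (g y) (g z) = entry L y z"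
proof -
  let ?S = "{L \<in> EndV N. \<forall>y\<in>cube N. \<forall>z\<in>cube N. entry L (g y) (g z) = entry L y z}"
  have gc: "g y \<in> cube N" if "y \<in> cube N" for y
    using bij_betwE[OF g] that by blast
  have inj: "g y = g z \<longleftrightarrow> y = z" if "y \<in> cube N" "z \<in> cube N" for y z
    using bij_betw_imp_inj_on[OF g] that by (auto dest: inj_onD)
  have hk: "ham N (g y) \<kappa> = ham N y \<kappa>" if "y \<in> cube N" for y
    using ham_g[OF that base_in_cube] by (simp add: base)
  have "Adj N \<in> ?S" "Adjs N \<kappa> \<in> ?S"
    by (auto simp: entry_Adj ham_g gc diag_Adjs entry_diag_op inj hk)
  then have "Talg N \<kappa> \<subseteq> ?S"
    by (intro Talg_minimal subalgebra_invariant_entries g)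
  then show ?thesis using L yz by auto
qed

end

section \<open>Coefficients of polynomials\<close>

abbreviation expt :: "4 \<Rightarrow> (4 \<Rightarrow>\<^sub>0 nat)" where
  "expt b \<equiv> Poly_Mapping.single b 1"

definition wt :: "(4 \<Rightarrow>\<^sub>0 nat) \<Rightarrow> complex" where
  "wt m = (\<Prod>c\<in>UNIV. fact (Poly_Mapping.lookup m c))"

text \<open>The coefficient for divided powers, that is, for monomials over their factorials;
  equivalently the partial derivative of f of multi-index m at the origin. The factorials match
  those in \<open>Btilde\<close>.\<close>

definition coef :: "poly4 \<Rightarrow> (4 \<Rightarrow>\<^sub>0 nat) \<Rightarrow> complex" where
  "coef f m = wt m * coeff_at f m"

lemma wt_nonzero [simp]: "wt m \<noteq> 0"
  by (simp add: wt_def)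

lemma wt_add_expt: "wt (m + expt b) = of_nat (Poly_Mapping.lookup m b + 1) * wt m"
proof -
  have "wt (m + expt b) = (\<Prod>c\<in>UNIV. (if c = b then of_nat (Poly_Mapping.lookup m b + 1) else 1)
      * fact (Poly_Mapping.lookup m c))"
    unfolding wt_def by (intro prod.cong) (auto simp: lookup_add lookup_single when_def)
  then show ?thesis by (simp add: prod.distrib wt_def)
qed

lemma coef_add: "coef (f + g) m = coef f m + coef g m"
  by (simp add: coef_def lookup_add distrib_left)

lemma coef_scale: "coef (pscale c f) m = c * coef f m"
  by (simp add: coef_def)

lemma coef_sum: "coef (sum f I) m = (\<Sum>i\<in>I. coef (f i) m)"
  by (simp add: coef_def lookup_sum sum_distrib_left)

lemma sub_expt_eq_iff:
  assumes "Poly_Mapping.lookup m b \<noteq> 0" shows "m - expt b = n \<longleftrightarrow> m = n + expt b"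
proof
  show "m - expt b = n \<Longrightarrow> m = n + expt b"
    using assms
    by (intro poly_mapping_eqI) (auto simp: lookup_add lookup_minus lookup_single when_def)
qed simp

lemma lookup_partial:
  "coeff_at (partial b f) n = of_nat (Poly_Mapping.lookup n b + 1) * coeff_at f (n + expt b)"
proof -
  have "coeff_at (partial b f) n
      = (\<Sum>m\<in>Poly_Mapping.keys f. coeff_at f m *
          coeff_at (Poly_Mapping.single (m - expt b) (of_nat (Poly_Mapping.lookup m b))) n)"
    by (simp add: partial_def lookup_lin_ext)
  also have "\<dots> = (\<Sum>m\<in>Poly_Mapping.keys f.
      if m = n + expt b then coeff_at f m * of_nat (Poly_Mapping.lookup n b + 1) else 0)"
  proof (rule sum.cong)
    fix m
    show "coeff_at f m * coeff_at (Poly_Mapping.single (m - expt b) (of_nat (Poly_Mapping.lookup m b))) n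
      = (if m = n + expt b then coeff_at f m * of_nat (Poly_Mapping.lookup n b + 1) else 0)"
    proof (cases "Poly_Mapping.lookup m b = 0")
      case True
      then have "m \<noteq> n + expt b" by (auto simp: lookup_add)
      then show ?thesis using True by simp
    next
      case False
      then show ?thesis
        using sub_expt_eq_iff[OF False, of n]
        by (auto simp: lookup_single when_def lookup_add)
    qed
  qed simp
  also have "\<dots> = of_nat (Poly_Mapping.lookup n b + 1) * coeff_at f (n + expt b)"
    by (simp add: in_keys_iff)
  finally show ?thesis .
qed

lemma lookup_var_times:
  "coeff_at (var a * g) m
    = (if Poly_Mapping.lookup m a = 0 then 0 else coeff_at g (m - expt a))"
proof -
  have "coeff_at (var a * g) m = (\<Sum>q. coeff_at g q when m = expt a + q)"
    by (simp add: var_def lookup_mult lookup_single when_mult)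
  also have "\<dots> = (if Poly_Mapping.lookup m a = 0 then 0 else coeff_at g (m - expt a))"
  proof (cases "Poly_Mapping.lookup m a = 0")
    case True
    then have "m \<noteq> expt a + q" for q by (auto simp: lookup_add)
    then show ?thesis using True by simp
  next
    case False
    then have "m = expt a + q \<longleftrightarrow> q = m - expt a" for q
      using sub_expt_eq_iff[OF False, of q] by (auto simp: add.commute)
    then show ?thesis using False by simp
  qed
  finally show ?thesis .
qed

text \<open>Differentiating brings down the exponent of b, which the change of weight absorbs;
  multiplying by \<open>var a\<close> leaves the exponent of a. Where that exponent is 0, the factor
  0 covers the truncated subtraction.\<close>

lemma coef_var_partial:
  "coef (var a * partial b f) m = of_nat (Poly_Mapping.lookup m a) * coef f (m - expt a + expt b)"
proof (cases "Poly_Mapping.lookup m a = 0")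
  case True
  then show ?thesis by (simp add: coef_def lookup_var_times)
next
  case False
  define n where "n = m - expt a"
  have m: "m = n + expt a" using sub_expt_eq_iff[OF False, of n] by (simp add: n_def)
  show ?thesis
    unfolding m by (simp add: coef_def lookup_var_times lookup_partial wt_add_expt lookup_add
        del: One_nat_def)
qed

lemma coef_P_act:
  "coef (P_act \<phi> f) m = (\<Sum>a\<in>UNIV. \<Sum>b\<in>UNIV.
     \<phi> $ a $ b * of_nat (Poly_Mapping.lookup m a) * coef f (m - expt a + expt b))"
proof -
  have "pscale c (var a) * g = pscale c (var a * g)" for c a g
    by (simp add: pscale_conv_mult mult_ac)
  then have "coef (P_act \<phi> f) m = (\<Sum>b\<in>UNIV. \<Sum>a\<in>UNIV.
     \<phi> $ a $ b * of_nat (Poly_Mapping.lookup m a) * coef f (m - expt a + expt b))"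
    by (simp add: P_act_def coef_sum sum_distrib_right coef_scale coef_var_partial mult.assoc)
  then show ?thesis by (subst sum.swap) simp
qed

section \<open>Permutation and diagonal matrices acting on coefficients\<close>

definition swap_mat :: "(4 \<Rightarrow> 4) \<Rightarrow> complex^4^4" where
  "swap_mat \<tau> = (\<chi> a b. if b = \<tau> a then 1 else 0)"

definition diag_mat :: "(4 \<Rightarrow> complex) \<Rightarrow> complex^4^4" where
  "diag_mat d = (\<chi> a b. if b = a then d a else 0)"

lemma coef_swap_mat: "coef (P_act (swap_mat \<tau>) f) m
  = (\<Sum>a\<in>UNIV. of_nat (Poly_Mapping.lookup m a) * coef f (m - expt a + expt (\<tau> a)))"
  by (simp add: coef_P_act swap_mat_def if_times)

lemma coef_diag_mat: "coef (P_act (diag_mat d) f) m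
  = (\<Sum>a\<in>UNIV. d a * of_nat (Poly_Mapping.lookup m a)) * coef f m"
proof -
  have "m - expt a + expt a = m" if "Poly_Mapping.lookup m a \<noteq> 0" for a
    using sub_expt_eq_iff[OF that, of "m - expt a"] by simp
  then have *: "d a * of_nat (Poly_Mapping.lookup m a) * coef f (m - expt a + expt a)
      = d a * of_nat (Poly_Mapping.lookup m a) * coef f m" for a
    by (cases "Poly_Mapping.lookup m a = 0") simp_all
  show ?thesis
    by (simp add: coef_P_act diag_mat_def if_times sum_distrib_right * del: One_nat_def)
qed

section \<open>Homogeneous polynomials as a module\<close>

lemma in_PN_iff: "f \<in> PN N \<longleftrightarrow> (\<forall>m. coef f m \<noteq> 0 \<longrightarrow> (\<Sum>b\<in>UNIV. Poly_Mapping.lookup m b) = N)"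
  by (auto simp: PN_def coef_def in_keys_iff)

lemma degree_add_expt:
  "(\<Sum>c\<in>UNIV. Poly_Mapping.lookup (m + expt b) c) = (\<Sum>c\<in>UNIV. Poly_Mapping.lookup m c) + 1"
  by (simp add: lookup_add lookup_single sum.distrib when_def)

lemma subspace_PN: "pv.subspace (PN N)"
proof (rule pv.subspaceI)
  fix f g assume "f \<in> PN N" "g \<in> PN N"
  then show "f + g \<in> PN N"
    unfolding in_PN_iff coef_add by (metis add.right_neutral)
qed (auto simp: in_PN_iff coef_scale, simp add: coef_def)

lemma P_act_in_PN: assumes "f \<in> PN N" shows "P_act \<phi> f \<in> PN N"
  unfolding in_PN_iff
proof (intro allI impI)
  fix m assume "coef (P_act \<phi> f) m \<noteq> 0"
  then have "\<exists>a b. Poly_Mapping.lookup m a \<noteq> 0 \<and> coef f (m - expt a + expt b) \<noteq> 0"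
    unfolding coef_P_act by (rule contrapos_np) (auto intro!: sum.neutral)
  then obtain a b where ab: "Poly_Mapping.lookup m a \<noteq> 0" "coef f (m - expt a + expt b) \<noteq> 0"
    by blast
  have "m = m - expt a + expt a"
    using sub_expt_eq_iff[OF ab(1), of "m - expt a"] by simp
  then have "(\<Sum>c\<in>UNIV. Poly_Mapping.lookup m c)
      = (\<Sum>c\<in>UNIV. Poly_Mapping.lookup (m - expt a + expt b) c)"
    by (metis degree_add_expt)
  then show "(\<Sum>c\<in>UNIV. Poly_Mapping.lookup m c) = N"
    using ab(2) assms by (simp add: in_PN_iff)
qed

lemma P_act_linear: "Vector_Spaces.linear pscale pscale (P_act \<phi>)"
  using P_act_derivation by (simp add: derivation_def)

text \<open>A commutator of derivations is a derivation, so it is enough to compare both sides on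
  the variables, where the action is by matrices.\<close>

lemma P_act_bracket: "P_act (lie_bracket \<phi> \<psi>) f = P_act \<phi> (P_act \<psi> f) - P_act \<psi> (P_act \<phi> f)"
proof -
  have add: "P_act \<phi> (f + g) = P_act \<phi> f + P_act \<phi> g"
    and scale: "P_act \<phi> (pscale c f) = pscale c (P_act \<phi> f)"
    and leib: "P_act \<phi> (f * g) = P_act \<phi> f * g + f * P_act \<phi> g" for \<phi> c f g
    using P_act_derivation[of \<phi>] by (simp_all add: derivation_def Vector_Spaces.linear_iff)
  have sum: "P_act \<phi> (sum h I) = (\<Sum>i\<in>I. P_act \<phi> (h i))" for \<phi> h and I :: "4 set"
    using P_act_linear[of \<phi>] by (simp add: linear_iff_module_hom module_hom.sum)
  let ?D = "\<lambda>f. P_act \<phi> (P_act \<psi> f) - P_act \<psi> (P_act \<phi> f)"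
  have "derivation ?D"
    unfolding derivation_def Vector_Spaces.linear_iff
    by (auto simp: pv.vector_space_axioms add scale leib pv.scale_right_diff_distrib algebra_simps)
  moreover have "?D (var b) = P_act (lie_bracket \<phi> \<psi>) (var b)" for b
  proof -
    have "P_act \<phi> (P_act \<psi> (var b)) = (\<Sum>c\<in>UNIV. pscale ((\<phi> ** \<psi>) $ c $ b) (var c))" for \<phi> \<psi>
    proof -
      have "P_act \<phi> (P_act \<psi> (var b))
          = (\<Sum>a\<in>UNIV. \<Sum>c\<in>UNIV. pscale (\<phi> $ c $ a * \<psi> $ a $ b) (var c))"
        by (simp add: P_act_var sum scale pv.scale_sum_right mult.commute)
      also have "\<dots> = (\<Sum>c\<in>UNIV. \<Sum>a\<in>UNIV. pscale (\<phi> $ c $ a * \<psi> $ a $ b) (var c))"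
        by (rule sum.swap)
      finally show ?thesis
        by (simp add: matrix_matrix_mult_def pv.scale_sum_left)
    qed
    then show ?thesis
      by (simp add: P_act_var lie_bracket_def pv.scale_left_diff_distrib sum_subtractf)
  qed
  ultimately have "?D = P_act (lie_bracket \<phi> \<psi>)"
    by (intro derivation_eqI P_act_derivation)
  then show ?thesis by metis
qed

lemma P_act_add_left: "P_act (\<phi> + \<psi>) f = P_act \<phi> f + P_act \<psi> f"
  by (simp add: P_act_def pv.scale_left_distrib sum.distrib distrib_right)

lemma P_act_scale_left: "P_act (mscale c \<phi>) f = pscale c (P_act \<phi> f)"
proof -
  have *: "pscale c g * h = pscale c (g * h)" for g h :: poly4
    by (simp add: pscale_conv_mult mult_ac)
  have **: "(\<Sum>a\<in>UNIV. pscale (c * \<phi> $ a $ b) (var a)) = pscale c (\<Sum>a\<in>UNIV. pscale (\<phi> $ a $ b) (var a))"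
    for b by (simp add: pv.scale_sum_right)
  show ?thesis
    unfolding P_act_def mscale_def vec_lambda_beta ** * pv.scale_sum_right[symmetric] ..
qed

lemma sl4_module_PN: "sl4_module pscale (PN N) P_act"
  unfolding sl4_module_def linear_on_subspace_def
  using P_act_linear
  by (auto simp: pv.vector_space_axioms subspace_PN P_act_in_PN P_act_bracket P_act_add_left
      P_act_scale_left Vector_Spaces.linear_iff)

section \<open>Profiles\<close>

text \<open>
  \<open>coord_type q i\<close> is 1, 2, 3, 4 according to whether the coordinate \<open>i\<close> is counted by
  \<open>r\<close>, \<open>s\<close>, \<open>t\<close> or \<open>u\<close> in the profile of \<open>q\<close>.
\<close>

definition coord_type :: "vertex \<times> vertex \<times> vertex \<Rightarrow> nat \<Rightarrow> 4" where
  "coord_type q i = (case q of (x, y, z) \<Rightarrow>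
     if x i = y i \<and> y i = z i then 1 else if y i = z i then 2 else if z i = x i then 3 else 4)"

definition expo :: "nat \<Rightarrow> vertex \<times> vertex \<times> vertex \<Rightarrow> (4 \<Rightarrow>\<^sub>0 nat)" where
  "expo N q = (\<Sum>i\<in>{1..N}. expt (coord_type q i))"

lemma lookup_expo: "Poly_Mapping.lookup (expo N q) c = card {i \<in> {1..N}. coord_type q i = c}"
  by (simp add: expo_def lookup_sum lookup_single when_def sum.inter_filter[symmetric])

text \<open>A coordinate takes only two values, so at least two of the three vertices agree there;
  hence the default value 4 means that z alone differs.\<close>

lemma coord_type_iffs:
  assumes "x \<in> cube N" "y \<in> cube N" "z \<in> cube N" "i \<in> {1..N}"
  shows "coord_type (x, y, z) i = 1 \<longleftrightarrow> x i = y i \<and> y i = z i"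
    "coord_type (x, y, z) i = 2 \<longleftrightarrow> x i \<noteq> y i \<and> y i = z i"
    "coord_type (x, y, z) i = 3 \<longleftrightarrow> y i \<noteq> z i \<and> z i = x i"
    "coord_type (x, y, z) i = 4 \<longleftrightarrow> z i \<noteq> x i \<and> x i = y i"
  using cube_values[OF assms(1,4)] cube_values[OF assms(2,4)] cube_values[OF assms(3,4)]
  by (elim disjE; simp add: coord_type_def)+

lemma profile_eq_expo:
  assumes "q \<in> cube N \<times> cube N \<times> cube N"
  shows "profile N q = (Poly_Mapping.lookup (expo N q) 1, Poly_Mapping.lookup (expo N q) 2,
    Poly_Mapping.lookup (expo N q) 3, Poly_Mapping.lookup (expo N q) 4)"
proof -
  obtain x y z where q: "q = (x, y, z)" "x \<in> cube N" "y \<in> cube N" "z \<in> cube N"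
    using assms by auto
  show ?thesis
    unfolding q(1) profile_def lookup_expo
    by (simp add: coord_type_iffs[OF q(2-4)] cong: conj_cong)
qed

lemma degree_expo: "(\<Sum>c\<in>UNIV. Poly_Mapping.lookup (expo N q) c) = N"
proof -
  have "(\<Sum>c\<in>UNIV. Poly_Mapping.lookup (expo N q) c)
      = (\<Sum>i\<in>{1..N}. \<Sum>c\<in>UNIV. if coord_type q i = c then 1 else 0)"
    unfolding expo_def lookup_sum lookup_single when_def by (rule sum.swap)
  then show ?thesis by simp
qed

text \<open>The factor \<open>lookup m a\<close> in \<open>coef_swap_mat\<close> counts the
  coordinates of type a, so the weighted sum over types becomes a sum with one term per
  coordinate.\<close>

lemma coef_swap_mat_expo: "coef (P_act (swap_mat \<tau>) f) (expo N q)
  = (\<Sum>k\<in>{1..N}. coef f (expo N q - expt (coord_type q k) + expt (\<tau> (coord_type q k))))"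
proof -
  let ?g = "\<lambda>a. coef f (expo N q - expt a + expt (\<tau> a))"
  have "(\<Sum>a\<in>UNIV. of_nat (Poly_Mapping.lookup (expo N q) a) * ?g a)
      = (\<Sum>a\<in>UNIV. \<Sum>k\<in>{1..N}. if coord_type q k = a then ?g a else 0)"
    unfolding lookup_expo by (simp add: sum.inter_filter[symmetric])
  also have "\<dots> = (\<Sum>k\<in>{1..N}. \<Sum>a\<in>UNIV. if coord_type q k = a then ?g a else 0)"
    by (rule sum.swap)
  finally show ?thesis
    unfolding coef_swap_mat by simp
qed

lemma expo_update:
  assumes k: "k \<in> {1..N}"
    and "\<And>i. i \<in> {1..N} \<Longrightarrow> coord_type q' i = (if i = k then c else coord_type q i)"
  shows "expo N q' = expo N q - expt (coord_type q k) + expt c"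
proof -
  have "expo N q' = expt c + (\<Sum>i\<in>{1..N} - {k}. expt (coord_type q i))"
    unfolding expo_def using assms by (simp add: sum.remove[of _ k])
  moreover have "expo N q = expt (coord_type q k) + (\<Sum>i\<in>{1..N} - {k}. expt (coord_type q i))"
    unfolding expo_def using k by (simp add: sum.remove[of _ k])
  ultimately show ?thesis by (simp add: add.commute)
qed

section \<open>Effect of flipping one coordinate\<close>

definition swap1 :: "4 \<Rightarrow> 4" where
  "swap1 c = (if c = 1 then 2 else if c = 2 then 1 else if c = 3 then 4 else 3)"
definition swap2 :: "4 \<Rightarrow> 4" where
  "swap2 c = (if c = 1 then 3 else if c = 3 then 1 else if c = 2 then 4 else 2)"
definition swap3 :: "4 \<Rightarrow> 4" where
  "swap3 c = (if c = 1 then 4 else if c = 4 then 1 else if c = 2 then 3 else 2)"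

lemma A_eq_swap_mat: "A1 = swap_mat swap1" "A2 = swap_mat swap2" "A3 = swap_mat swap3"
  unfolding vec_eq_iff forall_4
  by (simp_all add: A1_def A2_def A3_def mat_unit_def swap_mat_def swap1_def swap2_def swap3_def)

lemma As_eq_diag_mat:
  "A1s = diag_mat (\<lambda>c. if c = 1 \<or> c = 2 then 1 else -1)"
  "A2s = diag_mat (\<lambda>c. if c = 1 \<or> c = 3 then 1 else -1)"
  "A3s = diag_mat (\<lambda>c. if c = 1 \<or> c = 4 then 1 else -1)"
  unfolding vec_eq_iff forall_4
  by (simp_all add: A1s_def A2s_def A3s_def mat_unit_def diag_mat_def)

text \<open>A flip of one vertex acts on the four types by one of the three double transpositions,
  and these are the permutations underlying \<open>A1\<close>, \<open>A2\<close>,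
  \<open>A3\<close>.\<close>

lemma coord_type_flip_same:
  assumes "x \<in> cube N" "y \<in> cube N" "z \<in> cube N" "i \<in> {1..N}"
  shows "coord_type (flip i x, y, z) i = swap1 (coord_type (x, y, z) i)"
    and "coord_type (x, flip i y, z) i = swap2 (coord_type (x, y, z) i)"
    and "coord_type (x, y, flip i z) i = swap3 (coord_type (x, y, z) i)"
  using cube_values[OF assms(1,4)] cube_values[OF assms(2,4)] cube_values[OF assms(3,4)]
  by (elim disjE; simp add: coord_type_def flip_def swap1_def swap2_def swap3_def)+

lemma coord_type_flip_other:
  assumes "i \<noteq> k"
  shows "coord_type (flip k x, y, z) i = coord_type (x, y, z) i"
    and "coord_type (x, flip k y, z) i = coord_type (x, y, z) i"
    and "coord_type (x, y, flip k z) i = coord_type (x, y, z) i"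
  using assms by (simp_all add: coord_type_def flip_def)

lemma coord_type_flip:
  assumes "x \<in> cube N" "y \<in> cube N" "z \<in> cube N" "i \<in> {1..N}"
  shows "coord_type (flip k x, y, z) i
      = (if i = k then swap1 (coord_type (x, y, z) k) else coord_type (x, y, z) i)"
    and "coord_type (x, flip k y, z) i
      = (if i = k then swap2 (coord_type (x, y, z) k) else coord_type (x, y, z) i)"
    and "coord_type (x, y, flip k z) i
      = (if i = k then swap3 (coord_type (x, y, z) k) else coord_type (x, y, z) i)"
  using coord_type_flip_same[OF assms] coord_type_flip_other[of i k]
  by (cases "i = k"; simp)+

lemma coef_A_expo:
  assumes "x \<in> cube N" "y \<in> cube N" "z \<in> cube N"
  shows "coef (P_act A1 f) (expo N (x, y, z)) = (\<Sum>k\<in>{1..N}. coef f (expo N (flip k x, y, z)))"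
    and "coef (P_act A2 f) (expo N (x, y, z)) = (\<Sum>k\<in>{1..N}. coef f (expo N (x, flip k y, z)))"
    and "coef (P_act A3 f) (expo N (x, y, z)) = (\<Sum>k\<in>{1..N}. coef f (expo N (x, y, flip k z)))"
  unfolding A_eq_swap_mat coef_swap_mat_expo
  by (intro sum.cong refl arg_cong[where f = "coef f"] expo_update[symmetric]
      coord_type_flip[OF assms]; assumption)+

lemma coord_type_eq_iffs:
  assumes "x \<in> cube N" "y \<in> cube N" "z \<in> cube N" "i \<in> {1..N}"
  shows "x i = y i \<longleftrightarrow> coord_type (x, y, z) i = 1 \<or> coord_type (x, y, z) i = 4"
    and "x i = z i \<longleftrightarrow> coord_type (x, y, z) i = 1 \<or> coord_type (x, y, z) i = 3"
  unfolding coord_type_iffs[OF assms]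
  using cube_values[OF assms(1,4)] cube_values[OF assms(2,4)] cube_values[OF assms(3,4)]
  by (elim disjE; simp)+

lemma coord_type_neq_iffs:
  assumes "x \<in> cube N" "y \<in> cube N" "z \<in> cube N" "i \<in> {1..N}"
  shows "y i \<noteq> z i \<longleftrightarrow> coord_type (x, y, z) i = 3 \<or> coord_type (x, y, z) i = 4"
    and "y i \<noteq> x i \<longleftrightarrow> coord_type (x, y, z) i = 2 \<or> coord_type (x, y, z) i = 3"
    and "z i \<noteq> x i \<longleftrightarrow> coord_type (x, y, z) i = 2 \<or> coord_type (x, y, z) i = 4"
  unfolding coord_type_iffs[OF assms]
  using cube_values[OF assms(1,4)] cube_values[OF assms(2,4)] cube_values[OF assms(3,4)]
  by (elim disjE; simp)+

lemma ham_expo: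
  assumes "x \<in> cube N" "y \<in> cube N" "z \<in> cube N"
  defines "m \<equiv> Poly_Mapping.lookup (expo N (x, y, z))"
  shows "ham N y z = m 3 + m 4" "ham N y x = m 2 + m 3" "ham N z x = m 2 + m 4"
proof -
  have *: "card {i \<in> {1..N}. P i} = m a + m b"
    if "a \<noteq> b" "\<And>i. i \<in> {1..N} \<Longrightarrow> P i \<longleftrightarrow> coord_type (x, y, z) i = a \<or> coord_type (x, y, z) i = b"
    for P a b
  proof -
    have "{i \<in> {1..N}. P i}
        = {i \<in> {1..N}. coord_type (x, y, z) i = a} \<union> {i \<in> {1..N}. coord_type (x, y, z) i = b}"
      using that by auto
    then show ?thesis
      unfolding m_def lookup_expo using that(1) by (simp add: card_Un_disjoint disjoint_iff)
  qed
  show "ham N y z = m 3 + m 4" "ham N y x = m 2 + m 3" "ham N z x = m 2 + m 4"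
    unfolding ham_def by (rule *; simp add: coord_type_neq_iffs[OF assms(1-3)])+
qed

section \<open>Profiles as orbits of the isometries on triples\<close>

lemma expo_surj:
  assumes x: "x \<in> cube N" and m: "(\<Sum>c\<in>UNIV. Poly_Mapping.lookup m c) = N"
  obtains y z where "y \<in> cube N" "z \<in> cube N" "expo N (x, y, z) = m"
proof -
  \<comment> \<open>The coordinates are cut into four consecutive blocks, the block d having length
    \<open>lookup m d\<close>; y and z are chosen so that its coordinates have type d.\<close>
  define a b c where "a = Poly_Mapping.lookup m 1" and "b = a + Poly_Mapping.lookup m 2"
    and "c = b + Poly_Mapping.lookup m 3"
  have N: "N = c + Poly_Mapping.lookup m 4"
    using m by (simp add: sum_4 a_def b_def c_def)
  define t :: "nat \<Rightarrow> 4" where "t i = (if i \<le> a then 1 else if i \<le> b then 2 else if i \<le> c then 3 else 4)" for i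
  have le: "a \<le> b" "b \<le> c" "c \<le> N" by (simp_all add: b_def c_def N)
  have "{i \<in> {1..N}. t i = 1} = {1..a}" "{i \<in> {1..N}. t i = 2} = {a<..b}"
    "{i \<in> {1..N}. t i = 3} = {b<..c}" "{i \<in> {1..N}. t i = 4} = {c<..N}"
    using le by (auto simp: t_def split: if_splits)
  then have "\<forall>d. card {i \<in> {1..N}. t i = d} = Poly_Mapping.lookup m d"
    unfolding forall_4 by (simp add: a_def b_def c_def N)
  then have t: "card {i \<in> {1..N}. t i = d} = Poly_Mapping.lookup m d" for d by blast
  define y z where "y = restrict (\<lambda>i. if t i = 1 \<or> t i = 4 then x i else - x i) {1..N}"
    and "z = restrict (\<lambda>i. if t i = 1 \<or> t i = 3 then x i else - x i) {1..N}"
  have yz: "y \<in> cube N" "z \<in> cube N"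
    unfolding y_def z_def using cube_values[OF x] by (intro restrict_in_cube; force)+
  have "coord_type (x, y, z) i = t i" if i: "i \<in> {1..N}" for i
    using cube_values[OF x i] exhaust_4[of "t i"]
    by (elim disjE) (use i in \<open>simp_all add: coord_type_def y_def z_def\<close>)
  then have "Poly_Mapping.lookup (expo N (x, y, z)) d = Poly_Mapping.lookup m d" for d
    unfolding lookup_expo t[symmetric] by (intro arg_cong[where f = card]) auto
  then have "expo N (x, y, z) = m" by (rule poly_mapping_eqI)
  then show ?thesis using that yz by blast
qed

text \<open>Equal profiles provide a permutation of the coordinates that matches their types; it is
  followed by sign changes, which are forced by sending x to x'.\<close>

lemma expo_eq_imp_isometry:
  assumes xyz: "x \<in> cube N" "y \<in> cube N" "z \<in> cube N"
    and xyz': "x' \<in> cube N" "y' \<in> cube N" "z' \<in> cube N"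
    and eq: "expo N (x, y, z) = expo N (x', y', z')"
  obtains g where "bij_betw g (cube N) (cube N)"
    "\<And>v w. v \<in> cube N \<Longrightarrow> w \<in> cube N \<Longrightarrow> ham N (g v) (g w) = ham N v w"
    "g x = x'" "g y = y'" "g z = z'"
proof -
  let ?t = "coord_type (x, y, z)" and ?t' = "coord_type (x', y', z')"
  have "image_mset ?t' (mset_set {1..N}) = image_mset ?t (mset_set {1..N})"
  proof (rule multiset_eqI)
    fix c
    have count: "count (image_mset h (mset_set {1..N})) c = card {i \<in> {1..N}. h i = c}" for h :: "nat \<Rightarrow> 4"
      unfolding count_image_mset' by (auto intro!: arg_cong[where f = card])
    show "count (image_mset ?t' (mset_set {1..N})) c = count (image_mset ?t (mset_set {1..N})) c"
      unfolding count lookup_expo[symmetric] eq ..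
  qed
  then obtain p where p: "p permutes {1..N}" and t: "\<forall>i\<in>{1..N}. ?t' i = ?t (p i)"
    by (rule image_mset_eq_implies_permutes[rotated]) auto
  have pN: "p i \<in> {1..N}" if "i \<in> {1..N}" for i
    using permutes_in_image[OF p] that by blast
  \<comment> \<open>The sign \<open>x' i * x (p i)\<close> makes g carry x to x'. As the types
    record where y and z agree with x, it carries y and z along.\<close>
  define g where "g v = restrict (\<lambda>i. x' i * x (p i) * v (p i)) {1..N}" for v :: vertex
  have gc: "g v \<in> cube N" if "v \<in> cube N" for v
    unfolding g_def
  proof (rule restrict_in_cube)
    fix i assume i: "i \<in> {1..N}"
    show "x' i * x (p i) * v (p i) \<in> {1, -1}"
      using cube_values[OF xyz'(1) i] cube_values[OF xyz(1) pN[OF i]] cube_values[OF that pN[OF i]]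
      by (elim disjE) simp_all
  qed
  have ham_g: "ham N (g v) (g w) = ham N v w" if v: "v \<in> cube N" and w: "w \<in> cube N" for v w
  proof -
    have "g v i \<noteq> g w i \<longleftrightarrow> v (p i) \<noteq> w (p i)" if i: "i \<in> {1..N}" for i
      using i cube_values[OF xyz'(1) i] cube_values[OF xyz(1) pN[OF i]] by (auto simp: g_def)
    then have "{i \<in> {1..N}. g v i \<noteq> g w i} = {i \<in> {1..N}. v (p i) \<noteq> w (p i)}" by auto
    moreover have "p ` {i \<in> {1..N}. v (p i) \<noteq> w (p i)} = {i \<in> {1..N}. v i \<noteq> w i}"
    proof
      show "{i \<in> {1..N}. v i \<noteq> w i} \<subseteq> p ` {i \<in> {1..N}. v (p i) \<noteq> w (p i)}"
      proof
        fix j assume j: "j \<in> {i \<in> {1..N}. v i \<noteq> w i}"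
        then have "j \<in> p ` {1..N}" unfolding permutes_image[OF p] by blast
        then show "j \<in> p ` {i \<in> {1..N}. v (p i) \<noteq> w (p i)}" using j by blast
      qed
    qed (use pN in blast)
    moreover have "card (p ` {i \<in> {1..N}. v (p i) \<noteq> w (p i)}) = card {i \<in> {1..N}. v (p i) \<noteq> w (p i)}"
      by (rule card_image[OF permutes_inj_on[OF p]])
    ultimately show ?thesis
      unfolding ham_def by (simp only:)
  qed
  have inj: "inj_on g (cube N)"
  proof (rule inj_onI)
    fix v w assume vw: "v \<in> cube N" "w \<in> cube N" and "g v = g w"
    then have "ham N v w = 0"
      using ham_g[OF vw] by (simp add: ham_def)
    then show "v = w" using vw by (simp add: ham_eq_0)
  qed
  then have bij: "bij_betw g (cube N) (cube N)"
    unfolding bij_betw_def using gc endo_inj_surj[OF finite_cube _ inj] by blast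
  have gq: "g v = v'" if v: "v \<in> cube N" "v' \<in> cube N"
    and agree: "\<And>i. i \<in> {1..N} \<Longrightarrow> x' i = v' i \<longleftrightarrow> x (p i) = v (p i)" for v v'
  proof (rule cube_eqI[of _ N])
    fix i assume i: "i \<in> {1..N}"
    show "g v i = v' i"
      using agree[OF i] cube_values[OF xyz'(1) i] cube_values[OF xyz(1) pN[OF i]]
        cube_values[OF v(1) pN[OF i]] cube_values[OF v(2) i]
      by (elim disjE) (use i in \<open>simp_all add: g_def\<close>)
  qed (use v gc in auto)
  show ?thesis
  proof (rule that[OF bij ham_g])
    show "g x = x'" by (rule gq) (use xyz xyz' in auto)
    show "g y = y'"
      by (rule gq) (use xyz xyz' t pN in \<open>auto simp: coord_type_eq_iffs(1)[OF xyz] coord_type_eq_iffs(1)[OF xyz']\<close>)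
    show "g z = z'"
      by (rule gq) (use xyz xyz' t pN in \<open>auto simp: coord_type_eq_iffs(2)[OF xyz] coord_type_eq_iffs(2)[OF xyz']\<close>)
  qed auto
qed

section \<open>The map \<open>\<vartheta>\<close> on matrix entries\<close>

lemma expt_vector_eq_iff: "m = n \<longleftrightarrow>
    Poly_Mapping.lookup m 1 = Poly_Mapping.lookup n 1 \<and> Poly_Mapping.lookup m 2 = Poly_Mapping.lookup n 2 \<and>
    Poly_Mapping.lookup m 3 = Poly_Mapping.lookup n 3 \<and> Poly_Mapping.lookup m 4 = Poly_Mapping.lookup n 4"
  for m n :: "4 \<Rightarrow>\<^sub>0 nat"
  unfolding poly_mapping_eq_iff fun_eq_iff forall_4 ..

text \<open>The factor of \<open>ddag\<close> over the denominator in \<open>Btilde\<close>, that is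
  (N! 2^N)^(-1/2); the factorials in the numerator of \<open>Btilde\<close> are part of
  \<open>coef\<close>.\<close>

definition ddag_const :: "nat \<Rightarrow> complex" where
  "ddag_const N = complex_of_real (sqrt (fact N * 2 ^ N)) / (fact N * 2 ^ N)"

lemma lookup_ddag:
  "coeff_at (ddag N f) q
    = (if q \<in> cube N \<times> cube N \<times> cube N then ddag_const N * coef f (expo N q) else 0)"
proof -
  let ?X = "cube N \<times> cube N \<times> cube N"
  let ?L = Poly_Mapping.lookup
  have "coeff_at (Bsum N (?L m 1, ?L m 2, ?L m 3, ?L m 4)) q
      = (if q \<in> ?X \<and> m = expo N q then 1 else 0)" for m
  proof -
    have fin: "finite {q' \<in> ?X. profile N q' = (?L m 1, ?L m 2, ?L m 3, ?L m 4)}"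
      by (intro finite_Collect_conjI) auto
    have "coeff_at (Bsum N (?L m 1, ?L m 2, ?L m 3, ?L m 4)) q
      = (if q \<in> ?X \<and> profile N q = (?L m 1, ?L m 2, ?L m 3, ?L m 4) then 1 else 0)"
      unfolding Bsum_def lookup_sum lookup_single when_def using fin by (simp add: sum.delta')
    then show ?thesis
      by (auto simp: profile_eq_expo expt_vector_eq_iff)
  qed
  note Bsum = this
  have "coeff_at (ddag N f) q = (\<Sum>m\<in>Poly_Mapping.keys f.
      if m = expo N q then (if q \<in> ?X then ddag_const N * coef f m else 0) else 0)"
    unfolding ddag_def lookup_lin_ext
  proof (rule sum.cong)
    fix m
    have "wt m = fact (?L m 1) * fact (?L m 2) * fact (?L m 3) * fact (?L m 4)"
      unfolding wt_def UNIV_4 by (simp add: mult.assoc)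
    then have "coeff_at (Btilde N (?L m 1, ?L m 2, ?L m 3, ?L m 4)) q
        = wt m / (fact N * 2 ^ N) * (if q \<in> ?X \<and> m = expo N q then 1 else 0)"
      by (simp only: Btilde_def prod.case lookup_pscale Bsum)
    then show "coeff_at f m * coeff_at (pscale (complex_of_real (sqrt (fact N * 2 ^ N)))
        (Btilde N (?L m 1, ?L m 2, ?L m 3, ?L m 4))) q
      = (if m = expo N q then (if q \<in> ?X then ddag_const N * coef f m else 0) else 0)"
      by (simp only: lookup_pscale) (simp add: ddag_const_def coef_def)
  qed simp
  then show ?thesis by (auto simp: in_keys_iff coef_def)
qed

text \<open>The factor 2^(N/2) of \<open>eps\<close> cancels the power of 2, leaving
  (N!)^(-1/2).\<close>

definition vtheta_const :: "nat \<Rightarrow> complex" where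
  "vtheta_const N = ddag_const N * complex_of_real (2 powr (real N / 2))"

lemma vtheta_const_nonzero [simp]: "vtheta_const N \<noteq> 0"
  by (simp add: vtheta_const_def ddag_const_def)

lemma e_unit_in_EndV: "x \<in> cube N \<Longrightarrow> e_unit N x y \<in> EndV N"
  unfolding e_unit_def by auto

lemma vtheta_in_EndV: "vtheta N \<kappa> f \<in> EndV N"
  unfolding vtheta_def eps_def
  by (intro opv.subspace_sum[OF subspace_EndV])
    (auto intro!: EndV_scale e_unit_in_EndV opv.subspace_0[OF subspace_EndV])

lemma entry_vtheta:
  assumes "\<kappa> \<in> cube N" "y \<in> cube N" "z \<in> cube N"
  shows "entry (vtheta N \<kappa> f) y z = vtheta_const N * coef f (expo N (\<kappa>, y, z))"
proof -
  have "entry (vtheta N \<kappa> f) y z = (\<Sum>q\<in>cube N \<times> cube N \<times> cube N.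
      if q = (\<kappa>, y, z) then vtheta_const N * coef f (expo N q) else 0)"
    unfolding vtheta_def eps_def entry_sum
  proof (rule sum.cong)
    fix q assume "q \<in> cube N \<times> cube N \<times> cube N"
    moreover obtain a b c where q: "q = (a, b, c)" by (cases q)
    ultimately show "entry (case q of (x, y, z) \<Rightarrow> opscale (coeff_at (ddag N f) (x, y, z))
        (if x = \<kappa> then opscale (complex_of_real (2 powr (real N / 2))) (e_unit N y z) else 0)) y z
      = (if q = (\<kappa>, y, z) then vtheta_const N * coef f (expo N q) else 0)"
      using assms
      by (auto simp: lookup_ddag e_unit_def entry_on_basis lookup_single when_def vtheta_const_def)
  qed simp
  then show ?thesis using assms by (simp add: sum.delta)
qed

section \<open>Generation of \<open>sl\<^sub>4\<close>\<close>

lemma lie_bracket_diag_mat: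
  "lie_bracket (diag_mat d) M $ a $ b = (d a - d b) * M $ a $ b"
  by (simp add: lie_bracket_def diag_mat_def matrix_matrix_mult_def if_times
      if_distrib[where f = "\<lambda>t. u * t" for u] left_diff_distrib mult.commute[of "M $ a $ b"])

text \<open>A bracket with \<open>diag_mat d\<close> multiplies the entry at (c, \<tau> c) by 2 d c.
  The combination thus multiplies it by (1 + d a d c)(1 + d' a d' c)/4, which is 1 for c = a and 0
  otherwise, since the signs d, d' separate a from the other indices.\<close>

lemma mat_unit_from_swap_mat:
  assumes d: "\<And>c. d (\<tau> c) = - d c" "\<And>c. d c * d c = 1"
    and d': "\<And>c. d' (\<tau> c) = - d' c" "\<And>c. d' c * d' c = 1"
    and sep: "\<And>c. c \<noteq> a \<Longrightarrow> d c = - d a \<or> d' c = - d' a"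
  shows "mat_unit a (\<tau> a) = mscale (1 / 4) (swap_mat \<tau>
      + (mscale (d a / 2) (lie_bracket (diag_mat d) (swap_mat \<tau>))
      + (mscale (d' a / 2) (lie_bracket (diag_mat d') (swap_mat \<tau>))
      + mscale (d a * d' a / 4)
          (lie_bracket (diag_mat d) (lie_bracket (diag_mat d') (swap_mat \<tau>))))))"
proof -
  have "1 + (d a * d c + (d' a * d' c + d a * (d' a * (d c * d' c)))) = 0" if "c \<noteq> a" for c
  proof -
    have "(1 + d a * d c) * (1 + d' a * d' c) = 0"
      using sep[OF that] d(2)[of a] d'(2)[of a] by auto
    then show ?thesis by (simp add: algebra_simps)
  qed
  moreover have "(d a * d a) * (d' a * d' a) = 1"
    by (simp add: d d')
  then have "d a * (d' a * (d a * d' a)) = 1"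
    by (simp only: mult_ac)
  ultimately show ?thesis
    by (auto simp: vec_eq_iff mat_unit_def mscale_def lie_bracket_diag_mat swap_mat_def d d')
qed

text \<open>Each of \<open>A1\<close>, \<open>A2\<close>, \<open>A3\<close> is split into its four
  matrix units by the two diagonal matrices whose signs its permutation reverses; this gives all
  off-diagonal units. The diagonal part is spanned by \<open>A1s\<close>, \<open>A2s\<close>,
  \<open>A3s\<close>.\<close>

lemma sl4_generated:
  assumes add: "\<And>\<phi> \<psi>. \<phi> \<in> S \<Longrightarrow> \<psi> \<in> S \<Longrightarrow> \<phi> + \<psi> \<in> S"
    and scale: "\<And>c \<phi>. \<phi> \<in> S \<Longrightarrow> mscale c \<phi> \<in> S"
    and bracket: "\<And>\<phi> \<psi>. \<phi> \<in> S \<Longrightarrow> \<psi> \<in> S \<Longrightarrow> lie_bracket \<phi> \<psi> \<in> S"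
    and A: "A1 \<in> S" "A2 \<in> S" "A3 \<in> S" and As: "A1s \<in> S" "A2s \<in> S" "A3s \<in> S"
    and \<phi>: "\<phi> \<in> sl4"
  shows "\<phi> \<in> S"
proof -
  have unit: "mat_unit a (\<tau> a) \<in> S"
    if "swap_mat \<tau> \<in> S" "diag_mat d \<in> S" "diag_mat d' \<in> S"
      "\<forall>c. d (\<tau> c) = - d c \<and> d c * d c = 1" "\<forall>c. d' (\<tau> c) = - d' c \<and> d' c * d' c = 1"
      "\<forall>a c. c \<noteq> a \<longrightarrow> d c = - d a \<or> d' c = - d' a" for a \<tau> d d'
  proof -
    have "mat_unit a (\<tau> a) = mscale (1 / 4) (swap_mat \<tau>
        + (mscale (d a / 2) (lie_bracket (diag_mat d) (swap_mat \<tau>))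
        + (mscale (d' a / 2) (lie_bracket (diag_mat d') (swap_mat \<tau>))
        + mscale (d a * d' a / 4)
            (lie_bracket (diag_mat d) (lie_bracket (diag_mat d') (swap_mat \<tau>))))))"
      by (rule mat_unit_from_swap_mat) (use that in auto)
    also have "\<dots> \<in> S" by (intro add scale bracket that(1-3))
    finally show ?thesis .
  qed
  have u1: "mat_unit a (swap1 a) \<in> S" for a
    by (rule unit[OF A(1)[unfolded A_eq_swap_mat] As(2,3)[unfolded As_eq_diag_mat]])
      (simp_all add: forall_4 swap1_def)
  have u2: "mat_unit a (swap2 a) \<in> S" for a
    by (rule unit[OF A(2)[unfolded A_eq_swap_mat] As(1,3)[unfolded As_eq_diag_mat]])
      (simp_all add: forall_4 swap2_def)
  have u3: "mat_unit a (swap3 a) \<in> S" for a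
    by (rule unit[OF A(3)[unfolded A_eq_swap_mat] As(1,2)[unfolded As_eq_diag_mat]])
      (simp_all add: forall_4 swap3_def)
  have off: "mat_unit a b \<in> S" if "a \<noteq> b" for a b
  proof -
    have "b = swap1 a \<or> b = swap2 a \<or> b = swap3 a"
      using that exhaust_4[of a] exhaust_4[of b]
      by (elim disjE) (simp_all add: swap1_def swap2_def swap3_def)
    then show ?thesis using u1 u2 u3 by blast
  qed
  have "\<phi> $ 1 $ 1 + \<phi> $ 2 $ 2 + \<phi> $ 3 $ 3 + \<phi> $ 4 $ 4 = 0"
    using \<phi> by (simp add: sl4_def trace_def sum_4)
  then have tr: "\<phi> $ 4 $ 4 = - \<phi> $ 1 $ 1 - \<phi> $ 2 $ 2 - \<phi> $ 3 $ 3"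
    by (simp add: algebra_simps eq_neg_iff_add_eq_0)
  let ?u = "\<lambda>a b. mscale (\<phi> $ a $ b) (mat_unit a b)"
  \<comment> \<open>The coefficients of the diagonal matrices D are trace(\<phi> D)/4, simplified by
    trace zero.\<close>
  have "\<phi> = mscale ((\<phi> $ 1 $ 1 + \<phi> $ 2 $ 2) / 2) A1s + (mscale ((\<phi> $ 1 $ 1 + \<phi> $ 3 $ 3) / 2) A2s
      + (mscale ((\<phi> $ 1 $ 1 + \<phi> $ 4 $ 4) / 2) A3s
      + (?u 1 2 + (?u 1 3 + (?u 1 4 + (?u 2 1 + (?u 2 3 + (?u 2 4
      + (?u 3 1 + (?u 3 2 + (?u 3 4 + (?u 4 1 + (?u 4 2 + ?u 4 3)))))))))))))"
    unfolding vec_eq_iff forall_4 As_eq_diag_mat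
    by (simp add: mscale_def mat_unit_def diag_mat_def tr) (simp add: field_simps)
  moreover have "\<dots> \<in> S"
    by (intro add scale As off) simp_all
  ultimately show ?thesis by metis
qed

lemma sl4_add: "\<phi> \<in> sl4 \<Longrightarrow> \<psi> \<in> sl4 \<Longrightarrow> \<phi> + \<psi> \<in> sl4"
  by (simp add: sl4_def trace_add)

lemma sl4_scale: "\<phi> \<in> sl4 \<Longrightarrow> mscale c \<phi> \<in> sl4"
  by (simp add: sl4_def mscale_def trace_def sum_distrib_left[symmetric])

lemma sl4_bracket: "lie_bracket \<phi> \<psi> \<in> sl4"
  by (simp add: sl4_def lie_bracket_def trace_sub trace_mul_sym[of \<phi> \<psi>])

lemma A_in_sl4: "A1 \<in> sl4" "A2 \<in> sl4" "A3 \<in> sl4" "A1s \<in> sl4" "A2s \<in> sl4" "A3s \<in> sl4"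
  unfolding A_eq_swap_mat As_eq_diag_mat
  by (simp_all add: sl4_def trace_def sum_4 swap_mat_def diag_mat_def swap1_def swap2_def swap3_def)

section \<open>Transport of module structures\<close>

text \<open>As M' is the image of M, the equation \<open>eq\<close> determines \<rho>' on M', and
  each module law for \<rho>' is the image under f of the law for \<rho>.\<close>

lemma sl4_module_transport:
  assumes M: "sl4_module s M \<rho>" and s': "vector_space s'" and M': "module.subspace s' M'"
    and f: "linear_on_subspace s s' M f" and bij: "bij_betw f M M'"
    and eq: "\<And>\<phi> m. \<phi> \<in> sl4 \<Longrightarrow> m \<in> M \<Longrightarrow> \<rho>' \<phi> (f m) = f (\<rho> \<phi> m)"
  shows "sl4_module_iso s M \<rho> s' M' \<rho>' f"
proof -
  interpret s: vector_space s using M by (simp add: sl4_module_def)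
  interpret s': vector_space s' by (rule s')
  have sub: "s.subspace M" using M by (simp add: sl4_module_def)
  note add_M = s.subspace_add[OF sub] and scale_M = s.subspace_scale[OF sub]
  have act: "\<rho> \<phi> m \<in> M" if "\<phi> \<in> sl4" "m \<in> M" for \<phi> m
    using M that by (auto simp: sl4_module_def)
  have f_add: "f m + f n = f (m + n)" and f_scale: "s' c (f m) = f (s c m)"
    if "m \<in> M" "n \<in> M" for m n c
    using f that by (auto simp: linear_on_subspace_def)
  have f_diff: "f m - f n = f (m - n)" if "m \<in> M" "n \<in> M" for m n
  proof -
    have "f (m - n) + f n = f m"
      using f_add[OF s.subspace_diff[OF sub that] that(2)] by simp
    then show ?thesis by (simp add: algebra_simps)
  qed
  have \<rho>_lin: "\<rho> \<phi> (m + n) = \<rho> \<phi> m + \<rho> \<phi> n" "\<rho> \<phi> (s c m) = s c (\<rho> \<phi> m)"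
    "\<rho> (\<phi> + \<psi>) m = \<rho> \<phi> m + \<rho> \<psi> m" "\<rho> (mscale c \<phi>) m = s c (\<rho> \<phi> m)"
    "\<rho> (lie_bracket \<phi> \<psi>) m = \<rho> \<phi> (\<rho> \<psi> m) - \<rho> \<psi> (\<rho> \<phi> m)"
    if "\<phi> \<in> sl4" "\<psi> \<in> sl4" "m \<in> M" "n \<in> M" for \<phi> \<psi> m n c
    using M that by (simp_all add: sl4_module_def linear_on_subspace_def)
  have M'_eq: "M' = f ` M" using bij by (simp add: bij_betw_def)
  have "sl4_module s' M' \<rho>'"
    unfolding sl4_module_def linear_on_subspace_def
  proof (intro conjI ballI allI s' M')
    fix \<phi> \<psi> assume \<phi>: "\<phi> \<in> sl4" and \<psi>: "\<psi> \<in> sl4"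
    show "\<rho>' \<phi> ` M' \<subseteq> M'" using \<phi> by (auto simp: M'_eq eq act)
    fix u assume "u \<in> M'"
    then obtain m where m: "m \<in> M" "u = f m" by (auto simp: M'_eq)
    show "\<rho>' (\<phi> + \<psi>) u = \<rho>' \<phi> u + \<rho>' \<psi> u"
      using m \<phi> \<psi> by (simp add: eq sl4_add act f_add \<rho>_lin)
    show "\<rho>' (lie_bracket \<phi> \<psi>) u = \<rho>' \<phi> (\<rho>' \<psi> u) - \<rho>' \<psi> (\<rho>' \<phi> u)"
      using m \<phi> \<psi> by (simp add: eq sl4_bracket act f_diff \<rho>_lin)
    show "\<rho>' (mscale c \<phi>) u = s' c (\<rho>' \<phi> u)" for c
      using m \<phi> f_scale[of "\<rho> \<phi> m" "\<rho> \<phi> m"] by (simp add: eq sl4_scale act \<rho>_lin)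
    show "\<rho>' \<phi> (s' c u) = s' c (\<rho>' \<phi> u)" for c
      using m \<phi> f_scale[of "\<rho> \<phi> m" "\<rho> \<phi> m"] f_scale[of m m]
      by (simp add: eq scale_M act \<rho>_lin)
    fix v assume "v \<in> M'"
    then obtain n where n: "n \<in> M" "v = f n" by (auto simp: M'_eq)
    show "\<rho>' \<phi> (u + v) = \<rho>' \<phi> u + \<rho>' \<phi> v"
      using m n \<phi> by (simp add: eq add_M act f_add \<rho>_lin)
  qed
  then show ?thesis
    using M f bij eq by (simp add: sl4_module_iso_def)
qed

lemma sl4_module_linear:
  assumes "sl4_module opscale M \<rho>" "\<phi> \<in> sl4" "L \<in> M" "L' \<in> M"
  shows "\<rho> \<phi> (L + L') = \<rho> \<phi> L + \<rho> \<phi> L'" and "\<rho> \<phi> (opscale c L) = opscale c (\<rho> \<phi> L)"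
  using assms by (simp_all add: sl4_module_def linear_on_subspace_def)

text \<open>Two linear maps agree on a subspace. The set B may depend on \<phi>: unstarred
  generators are tested on one family, starred ones on the other.\<close>

lemma sl4_actions_agree_on_span:
  assumes M: "sl4_module opscale M \<rho>" "sl4_module opscale M \<rho>'" and \<phi>: "\<phi> \<in> sl4"
    and B: "B \<subseteq> M" "M \<subseteq> opv.span B" and eq: "\<And>L. L \<in> B \<Longrightarrow> \<rho> \<phi> L = \<rho>' \<phi> L"
    and L: "L \<in> M"
  shows "\<rho> \<phi> L = \<rho>' \<phi> L"
proof -
  have sub: "opv.subspace M" using M by (simp add: sl4_module_def)
  note lin = sl4_module_linear[OF M(1) \<phi>] sl4_module_linear[OF M(2) \<phi>]
  have "opv.subspace {L \<in> M. \<rho> \<phi> L = \<rho>' \<phi> L}"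
  proof (rule opv.subspaceI)
    show "0 \<in> {L \<in> M. \<rho> \<phi> L = \<rho>' \<phi> L}"
      using lin(2)[of 0 0 0] lin(4)[of 0 0 0] opv.subspace_0[OF sub] by simp
  qed (use lin opv.subspace_add[OF sub] opv.subspace_scale[OF sub] in \<open>auto simp del: plus_fun_apply\<close>)
  then have "opv.span B \<subseteq> {L \<in> M. \<rho> \<phi> L = \<rho>' \<phi> L}"
    using B eq by (intro opv.span_minimal) auto
  then show ?thesis using B L by auto
qed

section \<open>The isomorphism\<close>

context base_vertex
begin

lemma linear_vtheta: "Vector_Spaces.linear pscale opscale (vtheta N \<kappa>)"
  unfolding Vector_Spaces.linear_iff
proof (intro conjI allI pv.vector_space_axioms opv.vector_space_axioms)
  show "vtheta N \<kappa> (f + g) = vtheta N \<kappa> f + vtheta N \<kappa> g" for f g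
    by (rule EndV_eqI[of _ N])
      (auto intro!: opv.subspace_add[OF subspace_EndV]
        simp: vtheta_in_EndV entry_vtheta base_in_cube coef_add distrib_left simp del: plus_fun_apply)
  show "vtheta N \<kappa> (pscale c f) = opscale c (vtheta N \<kappa> f)" for c f
    by (rule EndV_eqI[of _ N])
      (auto simp: vtheta_in_EndV entry_vtheta base_in_cube coef_scale)
qed

text \<open>Every exponent of degree N is the profile of some (\<kappa>, y, z), so the matrix
  entries show all coefficients that an element of P_N can have.\<close>

lemma inj_on_vtheta: "inj_on (vtheta N \<kappa>) (PN N)"
proof (rule inj_onI)
  fix f g assume fg: "f \<in> PN N" "g \<in> PN N" and eq: "vtheta N \<kappa> f = vtheta N \<kappa> g"
  have "coef f m = coef g m" for m
  proof (cases "(\<Sum>c\<in>UNIV. Poly_Mapping.lookup m c) = N")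
    case True
    then obtain y z where yz: "y \<in> cube N" "z \<in> cube N" "expo N (\<kappa>, y, z) = m"
      using expo_surj[OF base_in_cube] by blast
    show ?thesis
      using entry_vtheta[OF base_in_cube yz(1,2), of f] entry_vtheta[OF base_in_cube yz(1,2), of g]
      by (simp add: eq yz(3))
  next
    case False
    then show ?thesis using fg by (metis in_PN_iff)
  qed
  then show "f = g"
    by (intro poly_mapping_eqI) (simp add: coef_def)
qed

lemma entry_Talg_expo:
  assumes L: "L \<in> Talg N \<kappa>" and "y \<in> cube N" "z \<in> cube N" "y' \<in> cube N" "z' \<in> cube N"
    and eq: "expo N (\<kappa>, y, z) = expo N (\<kappa>, y', z')"
  shows "entry L y z = entry L y' z'"
proof -
  obtain g where g: "bij_betw g (cube N) (cube N)"
    "\<And>v w. v \<in> cube N \<Longrightarrow> w \<in> cube N \<Longrightarrow> ham N (g v) (g w) = ham N v w"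
    "g \<kappa> = \<kappa>" "g y = y'" "g z = z'"
    by (rule expo_eq_imp_isometry[OF base_in_cube assms(2,3) base_in_cube assms(4,5) eq]) rule
  have "entry L (g y) (g z) = entry L y z"
    using g(2) by (intro entry_Talg_invariant[OF g(1) _ g(3) L assms(2,3)])
  then show ?thesis unfolding g(4,5) by (rule sym)
qed

lemma Talg_in_image:
  assumes L: "L \<in> Talg N \<kappa>" shows "L \<in> vtheta N \<kappa> ` PN N"
proof -
  let ?e = "\<lambda>(y, z). expo N (\<kappa>, y, z)"
  define M where "M = ?e ` (cube N \<times> cube N)"
  \<comment> \<open>\<open>inv_into\<close> picks some pair (y, z) with profile m; by
    \<open>entry_Talg_expo\<close> every pick gives the same entry. The divisor undoes the factors
    in \<open>entry_vtheta\<close> and \<open>coef\<close>.\<close>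
  define c where "c m = (case inv_into (cube N \<times> cube N) ?e m of (y, z) \<Rightarrow> entry L y z)
    / (vtheta_const N * wt m)" for m
  define f where "f = (\<Sum>m\<in>M. pscale (c m) (bvec m))"
  have fin: "finite M" by (simp add: M_def)
  have coef_f: "coef f m = (if m \<in> M then wt m * c m else 0)" for m
    using fin by (simp add: f_def coef_def lookup_sum lookup_single when_def if_distrib cong: if_cong)
  have "f \<in> PN N"
    unfolding in_PN_iff coef_f by (auto simp: M_def degree_expo)
  moreover have "vtheta N \<kappa> f = L"
  proof (rule EndV_eqI[of _ N])
    show "L \<in> EndV N" by (rule subalgebra_EndV[OF subalgebra_Talg[OF base_in_cube] L])
    fix y z assume yz: "y \<in> cube N" "z \<in> cube N"
    let ?m = "expo N (\<kappa>, y, z)"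
    have m: "?m \<in> M" using yz by (auto simp: M_def)
    obtain y' z' where y'z': "inv_into (cube N \<times> cube N) ?e ?m = (y', z')" by force
    then have "y' \<in> cube N" "z' \<in> cube N" "expo N (\<kappa>, y', z') = ?m"
      using inv_into_into[OF m[unfolded M_def]] f_inv_into_f[OF m[unfolded M_def]] by auto
    then have "entry L y' z' = entry L y z"
      using entry_Talg_expo[OF L] yz by blast
    then show "entry (vtheta N \<kappa> f) y z = entry L y z"
      using yz m by (simp add: entry_vtheta base_in_cube coef_f c_def y'z')
  qed (rule vtheta_in_EndV)
  ultimately show ?thesis by blast
qed

section \<open>The two families and their spans\<close>

definition fam :: "nat \<Rightarrow> nat \<Rightarrow> nat \<Rightarrow> hvec \<Rightarrow> hvec" where
  "fam h i j = Ei N i \<circ> Ahs N \<kappa> h \<circ> Ei N j"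

definition fams :: "nat \<Rightarrow> nat \<Rightarrow> nat \<Rightarrow> hvec \<Rightarrow> hvec" where
  "fams h i j = Eis N \<kappa> i \<circ> Ah N h \<circ> Eis N \<kappa> j"

lemma fams_in_EndV: "fams h i j \<in> EndV N"
  unfolding fams_def by (intro EndV_comp Eis_in_EndV Ah_in_EndV)

lemma dual_fams: "dual (fams h i j) = fam h i j"
  unfolding fams_def fam_def by (rule dual_family)

lemma entry_fams:
  assumes "y \<in> cube N" "z \<in> cube N"
  shows "entry (fams h i j) y z
    = (if ham N y \<kappa> = i \<and> ham N y z = h \<and> ham N z \<kappa> = j then 1 else 0)"
proof -
  have "entry (fams h i j) y z = entry (Eis N \<kappa> i \<circ> Ah N h) y z * (if ham N z \<kappa> = j then 1 else 0)"
    unfolding fams_def diag_Eis[of j]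
    by (rule entry_comp_diag_op) (use assms in auto)
  also have "entry (Eis N \<kappa> i \<circ> Ah N h) y z = (if ham N y \<kappa> = i then 1 else 0) * entry (Ah N h) y z"
    unfolding diag_Eis by (rule entry_diag_op_comp) (use assms in auto)
  finally show ?thesis using assms by (simp add: entry_Ah)
qed

text \<open>The three distances among \<kappa>, y, z together with N fix the profile, so the nonzero
  entries of the image of a monomial are exactly those of one member of the second family.\<close>

lemma vtheta_bvec:
  assumes m: "(\<Sum>c\<in>UNIV. Poly_Mapping.lookup m c) = N"
  defines "l \<equiv> Poly_Mapping.lookup m"
  shows "vtheta N \<kappa> (bvec m) = opscale (vtheta_const N * wt m) (fams (l 3 + l 4) (l 2 + l 3) (l 2 + l 4))"
proof (rule EndV_eqI[of _ N])
  fix y z assume yz: "y \<in> cube N" "z \<in> cube N"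
  let ?k = "Poly_Mapping.lookup (expo N (\<kappa>, y, z))"
  have "m = expo N (\<kappa>, y, z) \<longleftrightarrow> ham N y \<kappa> = l 2 + l 3 \<and> ham N y z = l 3 + l 4 \<and> ham N z \<kappa> = l 2 + l 4"
    using m degree_expo[of N "(\<kappa>, y, z)"]
    unfolding ham_expo[OF base_in_cube yz] expt_vector_eq_iff l_def sum_4 by auto
  then have "coef (bvec m) (expo N (\<kappa>, y, z))
      = (if ham N y \<kappa> = l 2 + l 3 \<and> ham N y z = l 3 + l 4 \<and> ham N z \<kappa> = l 2 + l 4 then wt m else 0)"
    by (simp only: coef_def) (auto simp: lookup_single when_def)
  then show "entry (vtheta N \<kappa> (bvec m)) y z
      = entry (opscale (vtheta_const N * wt m) (fams (l 3 + l 4) (l 2 + l 3) (l 2 + l 4))) y z"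
    using yz by (simp add: entry_vtheta base_in_cube entry_fams)
qed (auto intro: vtheta_in_EndV fams_in_EndV)

lemma vtheta_in_span_fams:
  assumes f: "f \<in> PN N" shows "vtheta N \<kappa> f \<in> opv.span {fams h i j | h i j. (h, i, j) \<in> Pdd N}"
proof -
  interpret v: Vector_Spaces.linear pscale opscale "vtheta N \<kappa>" by (rule linear_vtheta)
  have "f = (\<Sum>m\<in>Poly_Mapping.keys f. pscale (coeff_at f m) (bvec m))"
    by (rule poly_mapping_eqI)
      (auto simp: lookup_sum lookup_single when_def in_keys_iff if_distrib cong: if_cong)
  then have "vtheta N \<kappa> f = (\<Sum>m\<in>Poly_Mapping.keys f. opscale (coeff_at f m) (vtheta N \<kappa> (bvec m)))"
    by (metis (no_types, lifting) v.sum v.scale sum.cong)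
  also have "\<dots> \<in> opv.span {fams h i j | h i j. (h, i, j) \<in> Pdd N}"
  proof (intro opv.span_sum opv.span_scale)
    fix m assume "m \<in> Poly_Mapping.keys f"
    then have m: "(\<Sum>c\<in>UNIV. Poly_Mapping.lookup m c) = N" using f by (auto simp: PN_def)
    let ?l = "Poly_Mapping.lookup m"
    have "(?l 3 + ?l 4, ?l 2 + ?l 3, ?l 2 + ?l 4) \<in> Pdd N"
      using m by (auto simp: Pdd_def sum_4)
    then show "vtheta N \<kappa> (bvec m) \<in> opv.span {fams h i j | h i j. (h, i, j) \<in> Pdd N}"
      unfolding vtheta_bvec[OF m] by (intro opv.span_scale opv.span_base) blast
  qed
  finally show ?thesis .
qed

text \<open>A degenerate triple (\<kappa>, x, x) has a profile determined by the distance of x from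
  \<kappa>. The resulting isometry fixes \<kappa>, moves x to x' and preserves E_h, whose \<kappa>
  column is \<open>lam h\<close> over 2^N.\<close>

lemma lam_eq:
  assumes "x \<in> cube N" "x' \<in> cube N" "ham N x \<kappa> = ham N x' \<kappa>"
  shows "lam h x = lam h x'"
proof -
  have "expo N (\<kappa>, x, x) = expo N (\<kappa>, x', x')"
    using ham_expo[OF base_in_cube assms(1,1)] ham_expo[OF base_in_cube assms(2,2)] assms(3)
      degree_expo[of N "(\<kappa>, x, x)"] degree_expo[of N "(\<kappa>, x', x')"]
    unfolding expt_vector_eq_iff sum_4 by (simp add: ham_def)
  then obtain g where g: "bij_betw g (cube N) (cube N)"
    "\<And>v w. v \<in> cube N \<Longrightarrow> w \<in> cube N \<Longrightarrow> ham N (g v) (g w) = ham N v w"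
    "g \<kappa> = \<kappa>" "g x = x'" "g x = x'"
    by (rule expo_eq_imp_isometry[OF base_in_cube assms(1,1) base_in_cube assms(2,2)]) rule
  have "entry (Ei N h) x' \<kappa> = entry (Ei N h) x \<kappa>"
    using entry_Ei_invariant[OF g(1,2) assms(1) base_in_cube] unfolding g(3,4) .
  moreover have "2 ^ N * entry (Ei N h) v \<kappa> = lam h v" if "v \<in> cube N" for v
    using entry_diag_op[OF that, of "lam h" v] entry_diag_op[OF that, of "\<lambda>x. 2 ^ N * entry (Ei N h) x \<kappa>" v]
    unfolding diag_Ahs[symmetric] Ahs_eq_diag_op[symmetric] by simp
  ultimately show ?thesis using assms by metis
qed

text \<open>A diagonal operator that is constant on the spheres around \<kappa> is a combination of
  the E_i^*, which are in T.\<close>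

lemma Ahs_in_Talg: "Ahs N \<kappa> h \<in> Talg N \<kappa>"
proof -
  define c where "c i = lam h (SOME x. x \<in> cube N \<and> ham N x \<kappa> = i)" for i
  have c: "c (ham N x \<kappa>) = lam h x" if "x \<in> cube N" for x
    unfolding c_def
    by (rule someI2[where a = x]) (use that in \<open>auto intro: lam_eq\<close>)
  have "Ahs N \<kappa> h = (\<Sum>i\<in>{..N}. opscale (c i) (Eis N \<kappa> i))"
  proof (rule EndV_eqI[of _ N])
    fix y z assume yz: "y \<in> cube N" "z \<in> cube N"
    have "entry (\<Sum>i\<in>{..N}. opscale (c i) (Eis N \<kappa> i)) y z
        = (\<Sum>i\<in>{..N}. if ham N z \<kappa> = i then (if y = z then c i else 0) else 0)"
      unfolding entry_sum diag_Eis using yz by (intro sum.cong) (auto simp: entry_diag_op)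
    then show "entry (Ahs N \<kappa> h) y z = entry (\<Sum>i\<in>{..N}. opscale (c i) (Eis N \<kappa> i)) y z"
      unfolding diag_Ahs using ham_le[of N z \<kappa>] yz by (simp add: entry_diag_op c)
  qed (auto intro!: opv.subspace_sum[OF subspace_EndV])
  moreover have "\<dots> \<in> Talg N \<kappa>"
    using subalgebra_Talg[OF base_in_cube] Talg_generators
    by (intro opv.subspace_sum[OF subalgebra_subspace] subalgebra_scale Eis_in_subalgebra)
  ultimately show ?thesis by metis
qed

text \<open>A_h is the dual of A_h^*, so it lies in T without being written as a polynomial in
  \<open>Adj\<close>.\<close>

lemma fams_in_Talg: "fams h i j \<in> Talg N \<kappa>"
proof -
  note T = subalgebra_Talg[OF base_in_cube]
  have "Ah N h \<in> Talg N \<kappa>"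
    using dual_Talg[OF Ahs_in_Talg] by (simp add: dual_Ahs)
  then show ?thesis
    unfolding fams_def
    by (intro subalgebra_comp[OF T] Eis_in_subalgebra[OF T] Talg_generators)
qed

lemma fam_in_Talg: "fam h i j \<in> Talg N \<kappa>"
  unfolding dual_fams[symmetric] by (rule dual_Talg[OF fams_in_Talg])

lemma Talg_subset_span_fams: "Talg N \<kappa> \<subseteq> opv.span {fams h i j | h i j. (h, i, j) \<in> Pdd N}"
  using Talg_in_image vtheta_in_span_fams by blast

lemma Talg_subset_span_fam: "Talg N \<kappa> \<subseteq> opv.span {fam h i j | h i j. (h, i, j) \<in> Pdd N}"
proof
  note T = subalgebra_Talg[OF base_in_cube]
  let ?B = "{fam h i j | h i j. (h, i, j) \<in> Pdd N}"
  have "opv.subspace {L \<in> EndV N. dual L \<in> opv.span ?B}"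
  proof (rule opv.subspaceI)
    show "0 \<in> {L \<in> EndV N. dual L \<in> opv.span ?B}"
      using dual_scale[of 0 0] opv.subspace_0[OF subspace_EndV] by (simp add: opv.span_zero)
  qed (use opv.subspace_add[OF subspace_EndV] in
      \<open>auto simp: dual_add dual_scale opv.span_add opv.span_scale simp del: plus_fun_apply\<close>)
  then have *: "opv.span {fams h i j | h i j. (h, i, j) \<in> Pdd N} \<subseteq> {L \<in> EndV N. dual L \<in> opv.span ?B}"
    by (intro opv.span_minimal) (auto simp: fams_in_EndV dual_fams, rule opv.span_base, blast)
  fix L assume L: "L \<in> Talg N \<kappa>"
  then have "dual (dual L) \<in> opv.span ?B"
    using dual_Talg[OF L] Talg_subset_span_fams * by blast
  then show "L \<in> opv.span ?B"
    using subalgebra_EndV[OF T L] by (simp add: dual_dual)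
qed

lemma vtheta_image: "vtheta N \<kappa> ` PN N = Talg N \<kappa>"
proof
  have "opv.span {fams h i j | h i j. (h, i, j) \<in> Pdd N} \<subseteq> Talg N \<kappa>"
    by (rule opv.span_minimal)
      (auto simp: fams_in_Talg subalgebra_subspace[OF subalgebra_Talg[OF base_in_cube]])
  then show "vtheta N \<kappa> ` PN N \<subseteq> Talg N \<kappa>"
    using vtheta_in_span_fams by blast
qed (use Talg_in_image in blast)

section \<open>Action of the six generators\<close>

lemma vtheta_A2: "vtheta N \<kappa> (P_act A2 f) = Adj N \<circ> vtheta N \<kappa> f"
proof (rule EndV_eqI[of _ N])
  fix y z assume yz: "y \<in> cube N" "z \<in> cube N"
  have "entry (Adj N \<circ> vtheta N \<kappa> f) y z
      = (\<Sum>w\<in>cube N. if ham N y w = 1 then entry (vtheta N \<kappa> f) w z else 0)"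
    unfolding entry_comp[OF Adj_in_EndV] by (intro sum.cong) (auto simp: entry_Adj yz)
  also have "\<dots> = (\<Sum>k\<in>{1..N}. entry (vtheta N \<kappa> f) (flip k y) z)"
    by (rule sum_neighbours[OF yz(1)])
  finally show "entry (vtheta N \<kappa> (P_act A2 f)) y z = entry (Adj N \<circ> vtheta N \<kappa> f) y z"
    using yz by (simp add: entry_vtheta base_in_cube coef_A_expo sum_distrib_left)
qed (auto intro: vtheta_in_EndV)

lemma vtheta_A3: "vtheta N \<kappa> (P_act A3 f) = vtheta N \<kappa> f \<circ> Adj N"
proof (rule EndV_eqI[of _ N])
  fix y z assume yz: "y \<in> cube N" "z \<in> cube N"
  have "entry (vtheta N \<kappa> f \<circ> Adj N) y z
      = (\<Sum>w\<in>cube N. if ham N z w = 1 then entry (vtheta N \<kappa> f) y w else 0)"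
    unfolding entry_comp[OF vtheta_in_EndV] by (intro sum.cong) (auto simp: entry_Adj yz ham_commute)
  also have "\<dots> = (\<Sum>k\<in>{1..N}. entry (vtheta N \<kappa> f) y (flip k z))"
    by (rule sum_neighbours[OF yz(2)])
  finally show "entry (vtheta N \<kappa> (P_act A3 f)) y z = entry (vtheta N \<kappa> f \<circ> Adj N) y z"
    using yz by (simp add: entry_vtheta base_in_cube coef_A_expo sum_distrib_left)
qed (auto intro: vtheta_in_EndV)

lemma entry_fam:
  assumes "y \<in> cube N" "z \<in> cube N"
  shows "entry (fam h i j) y z
    = 2 ^ N * (\<Sum>x\<in>cube N. entry (Ei N i) y x * entry (Ei N h) x \<kappa> * entry (Ei N j) x z)"
proof -
  have "entry (fam h i j) y z = (\<Sum>x\<in>cube N. entry (Ei N i \<circ> Ahs N \<kappa> h) y x * entry (Ei N j) x z)"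
    unfolding fam_def by (rule entry_comp) auto
  also have "\<dots> = (\<Sum>x\<in>cube N. 2 ^ N * (entry (Ei N i) y x * entry (Ei N h) x \<kappa> * entry (Ei N j) x z))"
    unfolding Ahs_eq_diag_op by (intro sum.cong) (auto simp: entry_comp_diag_op)
  finally show ?thesis by (simp add: sum_distrib_left)
qed

text \<open>
  The matrix entries of \<open>fam h i j\<close> extend to a function of three vertices which is invariant under
  the automorphism group, and \<open>A1\<close> acts on it through the adjacency map in the first argument.
\<close>

lemma vtheta_A1_fam:
  assumes f: "vtheta N \<kappa> f = fam h i j"
  shows "vtheta N \<kappa> (P_act A1 f) = opscale (theta N h) (fam h i j)"
proof (rule EndV_eqI[of _ N])
  let ?F = "\<lambda>x y z. 2 ^ N * (\<Sum>v\<in>cube N. entry (Ei N i) y v * entry (Ei N h) v x * entry (Ei N j) v z)"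
  have F: "vtheta_const N * coef f (expo N (x, y, z)) = ?F x y z"
    if xyz: "x \<in> cube N" "y \<in> cube N" "z \<in> cube N" for x y z
  proof -
    \<comment> \<open>A triple of the same profile with first vertex \<kappa>, where the
      coefficients of f are entries of \<open>fam h i j\<close>; invariance of the idempotents
      carries the formula back to (x, y, z).\<close>
    obtain y' z' where y'z': "y' \<in> cube N" "z' \<in> cube N" and eq: "expo N (\<kappa>, y', z') = expo N (x, y, z)"
      using expo_surj[OF base_in_cube degree_expo[of N "(x, y, z)"]] by blast
    obtain g where g: "bij_betw g (cube N) (cube N)"
      and ham_g: "\<And>v w. v \<in> cube N \<Longrightarrow> w \<in> cube N \<Longrightarrow> ham N (g v) (g w) = ham N v w"
      and gx: "g x = \<kappa>" "g y = y'" "g z = z'"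
      by (rule expo_eq_imp_isometry[OF xyz base_in_cube y'z' eq[symmetric]]) rule
    note inv = entry_Ei_invariant[OF g ham_g]
    have "vtheta_const N * coef f (expo N (x, y, z)) = entry (fam h i j) y' z'"
      unfolding eq[symmetric] f[symmetric] by (rule entry_vtheta[OF base_in_cube y'z', symmetric])
    also have "\<dots> = ?F (g x) (g y) (g z)"
      unfolding entry_fam[OF y'z'] gx ..
    also have "(\<Sum>v\<in>cube N. entry (Ei N i) (g y) v * entry (Ei N h) v (g x) * entry (Ei N j) v (g z))
      = (\<Sum>v\<in>cube N. entry (Ei N i) (g y) (g v) * entry (Ei N h) (g v) (g x) * entry (Ei N j) (g v) (g z))"
      by (rule sum.reindex_bij_betw[OF g, symmetric])
    also have "\<dots> = (\<Sum>v\<in>cube N. entry (Ei N i) y v * entry (Ei N h) v x * entry (Ei N j) v z)"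
      by (intro sum.cong) (auto simp: inv xyz)
    finally show ?thesis .
  qed
  fix y z assume yz: "y \<in> cube N" "z \<in> cube N"
  \<comment> \<open>Flipping \<kappa> in all ways is right multiplication of E_h by
    \<open>Adj\<close>, read in column \<kappa>; this produces the eigenvalue.\<close>
  have Eh: "(\<Sum>k\<in>{1..N}. entry (Ei N h) v (flip k \<kappa>)) = theta N h * entry (Ei N h) v \<kappa>"
    if v: "v \<in> cube N" for v
  proof -
    have "(\<Sum>k\<in>{1..N}. entry (Ei N h) v (flip k \<kappa>))
        = (\<Sum>w\<in>cube N. if ham N \<kappa> w = 1 then entry (Ei N h) v w else 0)"
      by (rule sum_neighbours[OF base_in_cube, symmetric])
    also have "\<dots> = entry (Ei N h \<circ> Adj N) v \<kappa>"
      unfolding entry_comp[OF Ei_in_EndV]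
      by (intro sum.cong) (auto simp: entry_Adj base_in_cube ham_commute)
    finally show ?thesis by (simp add: Ei_Adj)
  qed
  have "entry (vtheta N \<kappa> (P_act A1 f)) y z = (\<Sum>k\<in>{1..N}. ?F (flip k \<kappa>) y z)"
    using yz by (simp add: entry_vtheta base_in_cube coef_A_expo sum_distrib_left F)
  also have "\<dots> = 2 ^ N * (\<Sum>v\<in>cube N. \<Sum>k\<in>{1..N}.
      entry (Ei N i) y v * entry (Ei N h) v (flip k \<kappa>) * entry (Ei N j) v z)"
    unfolding sum_distrib_left[symmetric] by (subst sum.swap) (rule refl)
  also have "\<dots> = 2 ^ N * (\<Sum>v\<in>cube N.
      theta N h * (entry (Ei N i) y v * entry (Ei N h) v \<kappa> * entry (Ei N j) v z))"
    by (intro arg_cong[where f = "\<lambda>t. 2 ^ N * t"] sum.cong refl)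
      (simp only: sum_distrib_right[symmetric] sum_distrib_left[symmetric] Eh mult_ac)
  also have "\<dots> = entry (opscale (theta N h) (fam h i j)) y z"
    using yz by (simp add: entry_fam sum_distrib_left[symmetric])
  finally show "entry (vtheta N \<kappa> (P_act A1 f)) y z = entry (opscale (theta N h) (fam h i j)) y z" .
qed (auto intro: vtheta_in_EndV subalgebra_EndV[OF subalgebra_Talg[OF base_in_cube] fam_in_Talg])

text \<open>A diagonal sign matrix multiplies the coefficient at m by N - 2 k, where k counts the
  coordinates whose type has sign -1. For \<open>A1s\<close> these are the types 3 and 4, where y
  and z differ; for \<open>A2s\<close> 2 and 4, where z differs from \<kappa>; for
  \<open>A3s\<close> 2 and 3, where y does. Hence the order h, j, i.\<close>

lemma vtheta_As_fams:
  assumes f: "vtheta N \<kappa> f = fams h i j"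
  shows "vtheta N \<kappa> (P_act A1s f) = opscale (theta N h) (fams h i j)"
    and "vtheta N \<kappa> (P_act A2s f) = opscale (theta N j) (fams h i j)"
    and "vtheta N \<kappa> (P_act A3s f) = opscale (theta N i) (fams h i j)"
proof -
  have *: "vtheta N \<kappa> (P_act (diag_mat d) f) = opscale c (fams h i j)"
    if "\<And>y z. y \<in> cube N \<Longrightarrow> z \<in> cube N \<Longrightarrow> ham N y \<kappa> = i \<Longrightarrow> ham N y z = h \<Longrightarrow> ham N z \<kappa> = j \<Longrightarrow>
      (\<Sum>a\<in>UNIV. d a * of_nat (Poly_Mapping.lookup (expo N (\<kappa>, y, z)) a)) = c" for d c
  proof (rule EndV_eqI[of _ N])
    fix y z assume yz: "y \<in> cube N" "z \<in> cube N"
    have "entry (vtheta N \<kappa> (P_act (diag_mat d) f)) y z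
        = (\<Sum>a\<in>UNIV. d a * of_nat (Poly_Mapping.lookup (expo N (\<kappa>, y, z)) a)) * entry (fams h i j) y z"
      unfolding f[symmetric] using yz by (simp add: entry_vtheta base_in_cube coef_diag_mat)
    also have "\<dots> = c * entry (fams h i j) y z"
      using that[OF yz] yz by (simp add: entry_fams)
    finally show "entry (vtheta N \<kappa> (P_act (diag_mat d) f)) y z = entry (opscale c (fams h i j)) y z"
      by simp
  qed (auto intro: vtheta_in_EndV fams_in_EndV)
  have theta: "(\<Sum>a\<in>UNIV. (if a = 1 \<or> a = 2 then 1 else -1) * of_nat (l a)) = theta N (ham N y z)"
    "(\<Sum>a\<in>UNIV. (if a = 1 \<or> a = 3 then 1 else -1) * of_nat (l a)) = theta N (ham N z \<kappa>)"
    "(\<Sum>a\<in>UNIV. (if a = 1 \<or> a = 4 then 1 else -1) * of_nat (l a)) = theta N (ham N y \<kappa>)"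
    if "y \<in> cube N" "z \<in> cube N" "l = Poly_Mapping.lookup (expo N (\<kappa>, y, z))" for y z l
  proof -
    have "(of_nat N :: complex) = of_nat (\<Sum>a\<in>UNIV. l a)"
      unfolding that degree_expo ..
    then show "(\<Sum>a\<in>UNIV. (if a = 1 \<or> a = 2 then 1 else -1) * of_nat (l a)) = theta N (ham N y z)"
      "(\<Sum>a\<in>UNIV. (if a = 1 \<or> a = 3 then 1 else -1) * of_nat (l a)) = theta N (ham N z \<kappa>)"
      "(\<Sum>a\<in>UNIV. (if a = 1 \<or> a = 4 then 1 else -1) * of_nat (l a)) = theta N (ham N y \<kappa>)"
      unfolding theta_def ham_expo[OF base_in_cube that(1,2)] that(3)[symmetric]
      by (simp_all add: sum_4)
  qed
  show "vtheta N \<kappa> (P_act A1s f) = opscale (theta N h) (fams h i j)"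
    "vtheta N \<kappa> (P_act A2s f) = opscale (theta N j) (fams h i j)"
    "vtheta N \<kappa> (P_act A3s f) = opscale (theta N i) (fams h i j)"
    unfolding As_eq_diag_mat by (rule *; simp only: theta[OF _ _ refl])+
qed

section \<open>Existence and uniqueness of the action\<close>

lemma vtheta_iso:
  assumes "\<And>\<phi> f. \<phi> \<in> sl4 \<Longrightarrow> f \<in> PN N \<Longrightarrow> \<rho> \<phi> (vtheta N \<kappa> f) = vtheta N \<kappa> (P_act \<phi> f)"
  shows "sl4_module_iso pscale (PN N) P_act opscale (Talg N \<kappa>) \<rho> (vtheta N \<kappa>)"
proof (rule sl4_module_transport)
  show "module.subspace opscale (Talg N \<kappa>)"
    by (rule subalgebra_subspace[OF subalgebra_Talg[OF base_in_cube]])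
  show "linear_on_subspace pscale opscale (PN N) (vtheta N \<kappa>)"
    using linear_vtheta by (simp add: linear_on_subspace_def Vector_Spaces.linear_iff)
  show "bij_betw (vtheta N \<kappa>) (PN N) (Talg N \<kappa>)"
    by (simp add: bij_betw_def inj_on_vtheta vtheta_image)
qed (use assms in \<open>auto simp: sl4_module_PN opv.vector_space_axioms\<close>)

lemma T_action_act:
  assumes act: "\<And>\<phi> f. f \<in> PN N \<Longrightarrow> act \<phi> (vtheta N \<kappa> f) = vtheta N \<kappa> (P_act \<phi> f)"
  shows "T_action N \<kappa> act"
proof -
  have iso: "sl4_module_iso pscale (PN N) P_act opscale (Talg N \<kappa>) act (vtheta N \<kappa>)"
    by (rule vtheta_iso) (rule act)
  have fam: "act A1 (fam h i j) = opscale (theta N h) (fam h i j)"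
    "act A2 (fam h i j) = opscale (theta N i) (fam h i j)"
    "act A3 (fam h i j) = opscale (theta N j) (fam h i j)" for h i j
  proof -
    obtain f where f: "f \<in> PN N" "vtheta N \<kappa> f = fam h i j"
      using fam_in_Talg[of h i j] unfolding vtheta_image[symmetric] by (metis imageE)
    have "Adj N \<circ> fam h i j = opscale (theta N i) (fam h i j)"
      unfolding fam_def comp_assoc[symmetric] Adj_Ei opscale_comp_left ..
    moreover have "fam h i j \<circ> Adj N = opscale (theta N j) (fam h i j)"
      unfolding fam_def comp_assoc Ei_Adj
      by (simp only: opscale_comp_right[OF Ei_in_EndV] opscale_comp_right[OF Ahs_in_EndV])
    ultimately show "act A1 (fam h i j) = opscale (theta N h) (fam h i j)"
      "act A2 (fam h i j) = opscale (theta N i) (fam h i j)"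
      "act A3 (fam h i j) = opscale (theta N j) (fam h i j)"
      using act[OF f(1)] vtheta_A1_fam[OF f(2)] by (simp_all only: f(2) vtheta_A2 vtheta_A3)
  qed
  have fams: "act A1s (fams h i j) = opscale (theta N h) (fams h i j)"
    "act A2s (fams h i j) = opscale (theta N j) (fams h i j)"
    "act A3s (fams h i j) = opscale (theta N i) (fams h i j)" for h i j
  proof -
    obtain f where f: "f \<in> PN N" "vtheta N \<kappa> f = fams h i j"
      using fams_in_Talg[of h i j] unfolding vtheta_image[symmetric] by (metis imageE)
    show "act A1s (fams h i j) = opscale (theta N h) (fams h i j)"
      "act A2s (fams h i j) = opscale (theta N j) (fams h i j)"
      "act A3s (fams h i j) = opscale (theta N i) (fams h i j)"
      using act[OF f(1)] vtheta_As_fams[OF f(2)] by (simp_all only: f(2))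
  qed
  show ?thesis
    unfolding T_action_def Let_def fam_def[symmetric] fams_def[symmetric]
    using iso by (auto simp: fam fams sl4_module_iso_def)
qed

lemma T_action_unique:
  assumes "T_action N \<kappa> \<rho>" "T_action N \<kappa> \<rho>'" "\<phi> \<in> sl4" "L \<in> Talg N \<kappa>"
  shows "\<rho> \<phi> L = \<rho>' \<phi> L"
proof -
  have M: "sl4_module opscale (Talg N \<kappa>) \<rho>" "sl4_module opscale (Talg N \<kappa>) \<rho>'"
    using assms by (simp_all add: T_action_def)
  \<comment> \<open>Agreement of the two actions is closed under brackets, so S is all of sl_4 once
    it contains the six generators.\<close>
  define S where "S = {\<phi> \<in> sl4. \<forall>L\<in>Talg N \<kappa>. \<rho> \<phi> L = \<rho>' \<phi> L}"
  have in_S: "\<phi> \<in> S"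
    if "\<phi> \<in> sl4" "B \<subseteq> Talg N \<kappa>" "Talg N \<kappa> \<subseteq> opv.span B"
      "\<And>L. L \<in> B \<Longrightarrow> \<rho> \<phi> L = \<rho>' \<phi> L" for \<phi> B
    using sl4_actions_agree_on_span[OF M that] that(1) by (simp add: S_def)
  note fam = in_S[OF _ _ Talg_subset_span_fam] and fams = in_S[OF _ _ Talg_subset_span_fams]
  have T: "\<And>h i j. (h, i, j) \<in> Pdd N \<Longrightarrow> \<rho> A1 (fam h i j) = opscale (theta N h) (fam h i j) \<and>
      \<rho> A2 (fam h i j) = opscale (theta N i) (fam h i j) \<and> \<rho> A3 (fam h i j) = opscale (theta N j) (fam h i j)"
    "\<And>h i j. (h, i, j) \<in> Pdd N \<Longrightarrow> \<rho> A1s (fams h i j) = opscale (theta N h) (fams h i j) \<and>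
      \<rho> A2s (fams h i j) = opscale (theta N j) (fams h i j) \<and> \<rho> A3s (fams h i j) = opscale (theta N i) (fams h i j)"
    if "T_action N \<kappa> \<rho>" for \<rho>
    using that unfolding T_action_def Let_def fam_def[symmetric] fams_def[symmetric] by fast+
  note T = T[OF assms(1)] T[OF assms(2)]
  have "\<phi> \<in> S"
  proof (rule sl4_generated)
    show "A1 \<in> S" "A2 \<in> S" "A3 \<in> S" by (rule fam; use fam_in_Talg in \<open>auto simp: A_in_sl4 T\<close>)+
    show "A1s \<in> S" "A2s \<in> S" "A3s \<in> S" by (rule fams; use fams_in_Talg in \<open>auto simp: A_in_sl4 T\<close>)+
    show "\<phi> + \<psi> \<in> S" if "\<phi> \<in> S" "\<psi> \<in> S" for \<phi> \<psi>
      using that M by (auto simp: S_def sl4_add sl4_module_def)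
    show "mscale c \<phi> \<in> S" if "\<phi> \<in> S" for c \<phi>
      using that M by (auto simp: S_def sl4_scale sl4_module_def)
    show "lie_bracket \<phi> \<psi> \<in> S" if "\<phi> \<in> S" "\<psi> \<in> S" for \<phi> \<psi>
    proof -
      \<comment> \<open>A bracket applies the action twice, so the intermediate result has to stay
        in T for agreement to be used again.\<close>
      have "\<rho> \<eta> L \<in> Talg N \<kappa>" "\<rho>' \<eta> L \<in> Talg N \<kappa>" if "\<eta> \<in> S" "L \<in> Talg N \<kappa>" for \<eta> L
        using that M by (auto simp: S_def sl4_module_def)
      then show ?thesis
        using that M by (auto simp: S_def sl4_bracket sl4_module_def)
    qed
  qed (rule assms(3))
  then show ?thesis using assms(4) by (simp add: S_def)
qed

end

theorem theorem18p21:
  fixes N :: nat and \<kappa> :: vertex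
  assumes "\<kappa> \<in> cube N"
  shows "(\<exists>\<rho>. T_action N \<kappa> \<rho>) \<and>
         (\<forall>\<rho>. T_action N \<kappa> \<rho> \<longrightarrow>
            sl4_module_iso pscale (PN N) P_act opscale (Talg N \<kappa>) \<rho> (vtheta N \<kappa>))"
proof -
  interpret base_vertex N \<kappa> by unfold_locales (rule assms)
  \<comment> \<open>The action transported from P_N; on T the inverse is genuine, as
    \<open>vtheta\<close> maps P_N bijectively onto T.\<close>
  define act where "act \<phi> L = vtheta N \<kappa> (P_act \<phi> (inv_into (PN N) (vtheta N \<kappa>) L))" for \<phi> L
  have act: "act \<phi> (vtheta N \<kappa> f) = vtheta N \<kappa> (P_act \<phi> f)" if "f \<in> PN N" for \<phi> f
    unfolding act_def inv_into_f_f[OF inj_on_vtheta that] ..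
  then have T: "T_action N \<kappa> act" by (rule T_action_act)
  have "sl4_module_iso pscale (PN N) P_act opscale (Talg N \<kappa>) \<rho> (vtheta N \<kappa>)"
    if \<rho>: "T_action N \<kappa> \<rho>" for \<rho>
  proof (rule vtheta_iso)
    fix \<phi> f assume \<phi>: "\<phi> \<in> sl4" and f: "f \<in> PN N"
    then have "vtheta N \<kappa> f \<in> Talg N \<kappa>" using vtheta_image by blast
    then show "\<rho> \<phi> (vtheta N \<kappa> f) = vtheta N \<kappa> (P_act \<phi> f)"
      using T_action_unique[OF \<rho> T \<phi>] act[OF f] by metis
  qed
  then show ?thesis using T by blast
qed

end
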